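(* Assume $\ell(h,z)\in[0,1]$ for all $h,z$. Let $\Gamma\subseteq\mathcal{M}_b(\mathcal{H})$ be such that $\Delta_{\mathcal{S}}\in\Gamma$, let $\P\in\mathcal{P}(\mathcal{H})$ be a data-free prior and $\delta\in(0,1)$. With probability at least $1-\delta$ over $\mathcal{S}\sim\mathcal{D}^m$, for all $\rho\in\mathcal{P}(\mathcal{H})$ and $\eta\in\mathcal{P}(\mathcal{H})$: (reverse-KL bound) \[ \mathbb{E}_{h\sim\rho}\Delta_{\mathcal{S}}(h)\le 2\mathrm{W}^{\Gamma}(\rho,\eta)+2\overline{\mathrm{KL}}(\eta\|\P)+\sqrt{\frac1m}+\ln\Big(1+\frac1m\Big)\sqrt{2m\ln\frac1\delta}; \] (Hellinger bound) \[ \mathbb{E}_{h\sim\rho}\Delta_{\mathcal{S}}(h)\le 2\mathrm{W}^{\Gamma}(\rho,\eta)+2H^2(\eta\|\P)+\sqrt{\frac1m}+\frac{2}{m+1}\sqrt{2m\ln\frac1\delta}; \] (TV bound) \[ \mathbb{E}_{h\sim\rho}\Delta_{\mathcal{S}}(h)\le \mathrm{W}^{\Gamma}(\rho,\eta)+TV(\eta,\P)+\sqrt{\frac{1}{4m}}+\sqrt{\frac{\ln\frac1\delta}{2m}}. \]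
   Context: Learning problem: hypothesis space $\mathcal{H}$, data space $\mathcal{Z}$, loss $\ell:\mathcal{H}\times\mathcal{Z}\to\mathbb{R}$, unknown distribution $\mathcal{D}$ on $\mathcal{Z}$, i.i.d. sample $\mathcal{S}=\{z_1,\dots,z_m\}\sim\mathcal{D}^m$; $R_{\mathcal{D}}(h)=\mathbb{E}_{z\sim\mathcal{D}}\ell(h,z)$, $\hat R_{\mathcal{S}}(h)=\frac1m\sum_i\ell(h,z_i)$, $\Delta_{\mathcal{S}}(h)=|R_{\mathcal{D}}(h)-\hat R_{\mathcal{S}}(h)|$. $\mathcal{P}(\mathcal{H})$ is the set of probability distributions on $\mathcal{H}$, $\mathcal{M}_b(\mathcal{H})$ the bounded measurable functions on $\mathcal{H}$; a data-free prior is fixed independently of $\mathcal{S}$. $\mathrm{W}^{\Gamma}(\rho,\eta):=\sup_{\varphi\in\Gamma}\{\mathbb{E}_{h\sim\rho}\varphi(h)-\mathbb{E}_{h\sim\eta}\varphi(h)\}$. If $\eta\ll\P$: reverse KL $\overline{\mathrm{KL}}(\eta\|\P)=-\mathbb{E}_{g\sim\P}\ln\frac{d\eta}{d\P}(g)$, squared Hellinger $H^2(\eta\|\P)=\mathbb{E}_{g\sim\P}\big(\sqrt{\tfrac{d\eta}{d\P}(g)}-1\big)^2$, total variation $TV(\eta,\P)=\mathbb{E}_{g\sim\P}\tfrac12\big|\tfrac{d\eta}{d\P}(g)-1\big|$; each is $+\infty$ if $\eta\not\ll\P$. *)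

theory Defs
  imports "HOL-Probability.Probability"
begin

definition Mb :: "'h measure \<Rightarrow> ('h \<Rightarrow> real) set" where
  "Mb H = {f. f \<in> borel_measurable H \<and> (\<exists>B. \<forall>x\<in>space H. \<bar>f x\<bar> \<le> B)}"

definition true_risk :: "'z measure \<Rightarrow> ('h \<Rightarrow> 'z \<Rightarrow> real) \<Rightarrow> 'h \<Rightarrow> real" where
  "true_risk D l h = (\<integral>z. l h z \<partial>D)"

definition emp_risk :: "nat \<Rightarrow> ('h \<Rightarrow> 'z \<Rightarrow> real) \<Rightarrow> (nat \<Rightarrow> 'z) \<Rightarrow> 'h \<Rightarrow> real" where
  "emp_risk m l S h = (1 / real m) * (\<Sum>i<m. l h (S i))"

definition gen_gap :: "'z measure \<Rightarrow> nat \<Rightarrow> ('h \<Rightarrow> 'z \<Rightarrow> real) \<Rightarrow> (nat \<Rightarrow> 'z) \<Rightarrow> 'h \<Rightarrow> real" where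
  "gen_gap D m l S h = \<bar>true_risk D l h - emp_risk m l S h\<bar>"

definition W_Gamma :: "('h \<Rightarrow> real) set \<Rightarrow> 'h measure \<Rightarrow> 'h measure \<Rightarrow> ereal" where
  "W_Gamma \<Gamma> \<rho> \<eta> = (SUP \<phi>\<in>\<Gamma>. ereal ((\<integral>h. \<phi> h \<partial>\<rho>) - (\<integral>h. \<phi> h \<partial>\<eta>)))"

definition dens :: "'h measure \<Rightarrow> 'h measure \<Rightarrow> 'h \<Rightarrow> real" where
  "dens P \<eta> g = enn2real (RN_deriv P \<eta> g)"

definition neg_ln :: "real \<Rightarrow> ereal" where
  "neg_ln x = (if x \<le> 0 then \<infinity> else ereal (- ln x))"

text \<open>Reverse KL: - E_P ln(d eta/dP), the extended Lebesgue integral written as the difference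
  of the integrals of the positive and negative parts; +infinity if not eta << P.\<close>
definition revKL :: "'h measure \<Rightarrow> 'h measure \<Rightarrow> ereal" where
  "revKL \<eta> P = (if absolutely_continuous P \<eta> then
     enn2ereal (\<integral>\<^sup>+g. e2ennreal (max 0 (neg_ln (dens P \<eta> g))) \<partial>P)
     - enn2ereal (\<integral>\<^sup>+g. e2ennreal (max 0 (- neg_ln (dens P \<eta> g))) \<partial>P)
   else \<infinity>)"

definition hellinger2 :: "'h measure \<Rightarrow> 'h measure \<Rightarrow> ereal" where
  "hellinger2 \<eta> P = (if absolutely_continuous P \<eta> then
     enn2ereal (\<integral>\<^sup>+g. ennreal ((sqrt (dens P \<eta> g) - 1)\<^sup>2) \<partial>P)
   else \<infinity>)"

definition TV :: "'h measure \<Rightarrow> 'h measure \<Rightarrow> ereal" where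
  "TV \<eta> P = (if absolutely_continuous P \<eta> then
     enn2ereal (\<integral>\<^sup>+g. ennreal (\<bar>dens P \<eta> g - 1\<bar> / 2) \<partial>P)
   else \<infinity>)"

end

theory Submission
  imports Defs
begin

text \<open>
  Write \<open>\<Delta>\<close> for the gap at the sample \<open>S\<close>, \<open>d h\<close> for the mean of \<open>\<Delta> h\<close> over samples and
  \<open>\<beta> = 1 / (2 \<surd>m)\<close>; the variance of the loss gives \<open>d \<le> \<beta>\<close>. The class \<open>\<Gamma>\<close> need not be symmetric,
  so \<open>W\<close> may be negative and doubling it is not free. But \<open>\<Gamma>\<close> contains the gaps of all samples;
  averaging over an independent sample gives \<open>W \<ge> - E\<^sub>\<eta> d\<close>, hence
  \<open>E\<^sub>\<rho> \<Delta> \<le> W + E\<^sub>\<eta> \<Delta> \<le> 2 W + E\<^sub>\<eta> (\<Delta> + d)\<close>. With \<open>v = (\<Delta> + d) / 2 - \<beta>\<close>, the pointwise inequality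
  \<open>f v \<le> (\<surd>f - 1)\<^sup>2 + v / (1 - v)\<close> for \<open>f = d\<eta>/dP\<close> yields
  \<open>E\<^sub>\<eta> (\<Delta> + d) \<le> 2 \<beta> + 2 H\<^sup>2 + 2 E\<^sub>P (v / (1 - v))\<close>, and the reverse KL divergence dominates \<open>H\<^sup>2\<close>.

  A single event serves all three bounds: \<open>E\<^sub>P \<phi>(\<Delta>) \<le> \<beta> + \<surd>(ln (1/\<delta>) / (2 m))\<close>, where \<open>\<phi>\<close> is
  1-Lipschitz (so that McDiarmid's inequality applies with differences \<open>1/m\<close>), lies above the identity
  (for total variation), has mean at most \<open>\<beta>\<close>, and satisfies \<open>2 v / (1 - v) \<le> \<lambda> (\<phi>(\<Delta>) - \<beta>)\<close> for a small
  enough \<open>\<lambda>\<close>. For \<open>m \<ge> 2\<close> one can take \<open>\<phi>(x) = max x ((x + d) / 2)\<close>; its mean is at most \<open>\<beta>\<close> as soon as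
  \<open>d \<le> 15/17 \<beta>\<close>, which follows from de Moivre's formula for the mean absolute deviation of the
  binomial distribution. For \<open>m = 1\<close> this fails and \<open>\<phi>(x) = x\<^sup>2 + 1/4\<close> on \<open>[0, 1/2]\<close> is used.
\<close>

section \<open>Mean absolute deviation of the binomial distribution\<close>

text \<open>The right side minus the left side vanishes at 0 and has derivative
  \<open>x ^ 4 / (6 * (1 + x)\<^sup>2 * (2 + x)\<^sup>2)\<close>. At \<open>t = 1 / n\<close>,
  multiplication by \<open>n + 1 / 2\<close> turns the two summands into \<open>1\<close> and
  \<open>1 / (12 * n * (n + 1))\<close>, and the latter telescopes.\<close>

lemma ln_one_plus_le_stirling:
  fixes t :: real
  assumes "0 \<le> t"
  shows "ln (1 + t) \<le> 2 * t / (2 + t) + t ^ 3 / (6 * (1 + t) * (2 + t))"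
proof -
  let ?f = "\<lambda>t::real. 2 * t / (2 + t) + t ^ 3 / (6 * (1 + t) * (2 + t)) - ln (1 + t)"
  have "?f 0 \<le> ?f t"
  proof (rule DERIV_nonneg_imp_nondecreasing[OF assms])
    fix x :: real assume x: "0 \<le> x" "x \<le> t"
    have "(?f has_real_derivative
        ((2 * (2 + x) - 2 * x) / (2 + x)\<^sup>2
         + (3 * x\<^sup>2 * (6 * (1 + x) * (2 + x)) - x ^ 3 * (6 * (2 + x) + 6 * (1 + x))) / (6 * (1 + x) * (2 + x))\<^sup>2
         - 1 / (1 + x))) (at x)"
      using x by (auto intro!: derivative_eq_intros simp: power2_eq_square)
    moreover have "(2 * (2 + x) - 2 * x) / (2 + x)\<^sup>2
         + (3 * x\<^sup>2 * (6 * (1 + x) * (2 + x)) - x ^ 3 * (6 * (2 + x) + 6 * (1 + x))) / (6 * (1 + x) * (2 + x))\<^sup>2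
         - 1 / (1 + x) = x ^ 4 / (6 * (1 + x)\<^sup>2 * (2 + x)\<^sup>2)"
      using x by (simp add: divide_simps) (simp add: algebra_simps power2_eq_square power3_eq_cube power4_eq_xxxx)
    moreover have "0 \<le> x ^ 4 / (6 * (1 + x)\<^sup>2 * (2 + x)\<^sup>2)" by simp
    ultimately show "\<exists>y. (?f has_real_derivative y) (at x) \<and> 0 \<le> y"
      by (intro exI conjI) (assumption, simp only:)
  qed
  thus ?thesis by simp
qed

text \<open>For positive \<open>n\<close>, the logarithm of
  \<open>n ^ n * sqrt n * exp (- n) / fact n\<close>. By Stirling's formula its limit is
  \<open>- ln (2 * pi) / 2\<close>, about -0.919, so the constant -11/12 used below is close to
  optimal.\<close>

definition stirling_defect :: "nat \<Rightarrow> real" where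
  "stirling_defect n = real n * ln (real n) + ln (real n) / 2 - real n - ln (fact n)"

lemma stirling_defect_Suc:
  assumes "0 < n"
  shows "stirling_defect (Suc n) - stirling_defect n = (real n + 1 / 2) * (ln (real n + 1) - ln (real n)) - 1"
proof -
  have "ln (fact (Suc n) :: real) = ln (real n + 1) + ln (fact n)"
    by (simp add: ln_mult add.commute)
  thus ?thesis unfolding stirling_defect_def by (simp add: algebra_simps)
qed

text \<open>Each increment is nonnegative because \<open>ln (1 + 1 / n)\<close> is at least
  \<open>2 / (2 * n + 1)\<close>.\<close>

lemma stirling_defect_mono:
  assumes "0 < k" "k \<le> n"
  shows "stirling_defect k \<le> stirling_defect n"
  using assms(2)
proof (induction n rule: dec_induct)
  case (step n)
  have n: "0 < real n" using step assms by simp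
  have "2 / (2 * real n + 1) \<le> ln (real n + 1) - ln (real n)"
    using ln_inverse_approx_ge[of "real n" "real n + 1"] n by simp
  hence "(real n + 1 / 2) * (2 / (2 * real n + 1)) \<le> (real n + 1 / 2) * (ln (real n + 1) - ln (real n))"
    using n by (intro mult_left_mono) auto
  moreover have "(real n + 1 / 2) * (2 / (2 * real n + 1)) = 1" using n by (simp add: field_simps)
  ultimately show ?case using stirling_defect_Suc[of n] n step by linarith
qed simp

text \<open>Equality holds at \<open>n = 1\<close>, and by the cubic bound on the logarithm each
  increment is at most \<open>1 / (12 * n) - 1 / (12 * (n + 1))\<close>.\<close>

lemma stirling_defect_le:
  assumes "0 < n"
  shows "stirling_defect n \<le> - 11 / 12 - 1 / (12 * real n)"
  using assms
proof (induction n rule: nat_induct_non_zero)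
  case 1
  show ?case by (simp add: stirling_defect_def)
next
  case (Suc n)
  have n: "0 < real n" using Suc by simp
  have "ln (real n + 1) - ln (real n) = ln (1 + 1 / real n)"
    using n ln_div[of "real n + 1" "real n"] by (simp add: add_divide_distrib add.commute)
  also have "\<dots> \<le> 2 * (1 / real n) / (2 + 1 / real n)
      + (1 / real n) ^ 3 / (6 * (1 + 1 / real n) * (2 + 1 / real n))"
    by (rule ln_one_plus_le_stirling) simp
  finally have "(real n + 1 / 2) * (ln (real n + 1) - ln (real n))
      \<le> (real n + 1 / 2) * (2 * (1 / real n) / (2 + 1 / real n)
      + (1 / real n) ^ 3 / (6 * (1 + 1 / real n) * (2 + 1 / real n)))"
    using n by (intro mult_left_mono) auto
  also have "\<dots> = 1 + (1 / (12 * real n) - 1 / (12 * real (Suc n)))"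
    using n by (simp add: divide_simps power3_eq_cube)
       (simp add: algebra_simps power2_eq_square power3_eq_cube)
  finally show ?case using stirling_defect_Suc[of n] Suc by linarith
qed

section \<open>The largest term in de Moivre's formula\<close>

text \<open>The product is largest at \<open>p = k / (k + j)\<close>. Applying
  \<open>ln y \<le> y - 1\<close> to the ratios of \<open>p\<close> and \<open>q\<close> to their
  optimal values, with weights \<open>k\<close> and \<open>j\<close>, makes the right sides cancel
  (Gibbs' inequality).\<close>

lemma power_mult_power_le:
  fixes p q :: real
  assumes "0 \<le> p" "0 \<le> q" "p + q = 1" "0 < k" "0 < j"
  shows "p ^ k * q ^ j \<le> real k ^ k * real j ^ j / real (k + j) ^ (k + j)"
proof (cases "p = 0 \<or> q = 0")
  case True
  hence "p ^ k * q ^ j = 0" using assms by (auto simp: zero_power)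
  thus ?thesis by (simp only:) simp
next
  case False
  let ?N = "real (k + j)"
  have pq: "0 < p" "0 < q" using False assms by auto
  have "real k * ln (p * ?N / real k) \<le> real k * (p * ?N / real k - 1)"
    using pq assms by (intro mult_left_mono ln_le_minus_one) auto
  moreover have "real j * ln (q * ?N / real j) \<le> real j * (q * ?N / real j - 1)"
    using pq assms by (intro mult_left_mono ln_le_minus_one) auto
  moreover have "real k * (p * ?N / real k - 1) + real j * (q * ?N / real j - 1) = (p + q) * ?N - ?N"
    using assms(4,5) by (simp add: field_simps)
  moreover have "(p + q) * ?N - ?N = 0" using assms by (simp only:) simp
  ultimately have "real k * ln (p * ?N / real k) + real j * ln (q * ?N / real j) \<le> 0"
    by (metis (no_types) add_mono)
  hence "exp (real k * ln (p * ?N / real k) + real j * ln (q * ?N / real j)) \<le> 1" by simp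
  hence "(p * ?N / real k) ^ k * (q * ?N / real j) ^ j \<le> 1"
    using pq assms by (simp add: exp_add exp_of_nat_mult)
  hence "p ^ k * q ^ j * (?N ^ k * ?N ^ j) / (real k ^ k * real j ^ j) \<le> 1"
    by (simp only: power_divide power_mult_distrib times_divide_times_eq ac_simps)
  thus ?thesis using assms by (simp add: power_add pos_divide_le_eq pos_le_divide_eq)
qed

text \<open>The left side is twice the maximum over \<open>p\<close> of
  \<open>k * (n choose k) * p ^ k * (1 - p) ^ (n + 1 - k)\<close>. With \<open>N = n + 1\<close> and
  \<open>j = N - k\<close> it is a product of factorials and powers, and the Stirling bounds give
  \<open>?Q\<^sup>2 \<le> N / 4 * exp (- 11 / 6)\<close>.\<close>

lemma binomial_central_term_le_large:
  assumes "5 \<le> n" "1 \<le> k" "k \<le> n"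
  shows "2 * (real k * real (n choose k) * (real k ^ k * real (n + 1 - k) ^ (n + 1 - k) / real (n + 1) ^ (n + 1)))
          \<le> 15 / 34 * sqrt (real n)"
proof -
  define j where "j = n + 1 - k"
  define N where "N = n + 1"
  have j: "0 < j" "N = k + j" "0 < k" "0 < N" and jn: "n - k = j - 1" "k + (j - 1) = n" using assms by (auto simp: j_def N_def)
  have aux: "2 * a \<le> c - 11 / 6" if "a \<le> b / 2 - 11 / 12" "c = b" for a b c :: real
    using that by simp
  let ?Q = "real k * real (n choose k) * (real k ^ k * real j ^ j / real N ^ N)"
  have Q0: "0 < ?Q" using assms j by simp
  have "real (n choose k) = fact n / (fact k * fact (j - 1))"
    using binomial_fact[of k n, where 'a=real] assms jn by simp
  moreover have "fact n = (fact N / real N :: real)" by (simp add: N_def field_simps)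
  moreover have "fact (j - 1) = (fact j / real j :: real)" using j by (cases j) (auto simp: field_simps)
  ultimately have Q: "?Q = real k * real j / real N * (fact N / (fact k * fact j)) * (real k ^ k * real j ^ j / real N ^ N)"
    by simp
  have pos: "real k \<noteq> 0" "real j \<noteq> 0" "real N \<noteq> 0" using j by auto
  have "ln ?Q = ln (real k) + ln (real j) - ln (real N) + (ln (fact N) - (ln (fact k) + ln (fact j)))
      + (real k * ln (real k) + real j * ln (real j) - real N * ln (real N))"
    unfolding Q using pos by (simp add: ln_mult ln_div ln_realpow)
  also have "\<dots> = (ln (real k) + ln (real j) - ln (real N)) / 2
      + stirling_defect k + stirling_defect j - stirling_defect N"
    using \<open>N = k + j\<close> by (simp add: stirling_defect_def field_simps)
  \<comment> \<open>One of the two defects is absorbed by that of \<open>N\<close> through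
    monotonicity; the other is at most -11/12.\<close>
  also have "\<dots> \<le> (ln (real k) + ln (real j) - ln (real N)) / 2 - 11 / 12"
  proof (cases "k \<le> j")
    case True
    have "0 \<le> 1 / (12 * real k)" by simp
    thus ?thesis using stirling_defect_mono[of j N] stirling_defect_le[of k] j by linarith
  next
    case False
    have "0 \<le> 1 / (12 * real j)" by simp
    thus ?thesis using stirling_defect_mono[of k N] stirling_defect_le[of j] j by linarith
  qed
  finally have "ln ?Q \<le> (ln (real k) + ln (real j) - ln (real N)) / 2 - 11 / 12" .
  moreover have "ln (real k * real j / real N) = ln (real k) + ln (real j) - ln (real N)"
    using pos by (simp only: ln_mult[of "real k" "real j"] ln_div[of "real k * real j"] mult_eq_0_iff) simp
  ultimately have "2 * ln ?Q \<le> ln (real k * real j / real N) - 11 / 6"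
    by (metis (no_types) aux)
  also have "\<dots> \<le> ln (real N / 4) - 11 / 6"
  proof -
    have "4 * (real k * real j) \<le> real N * real N"
      using sum_squares_bound[of "real k" "real j"] by (simp add: j algebra_simps power2_eq_square)
    hence "real k * real j / real N \<le> real N / 4" using j by (simp add: field_simps)
    thus ?thesis using j by simp
  qed
  finally have "ln (?Q\<^sup>2) \<le> ln (real N / 4) - 11 / 6" using Q0 by (simp add: ln_realpow)
  also have "\<dots> = ln (real N / 4 * exp (- 11 / 6))"
    using j by (subst ln_mult_pos) auto
  finally have *: "?Q\<^sup>2 \<le> real N / 4 * exp (- 11 / 6)"
    using Q0 j by (subst (asm) ln_le_cancel_iff) (simp_all only: zero_less_power zero_less_mult_iff zero_less_divide_iff exp_gt_zero of_nat_0_less_iff zero_less_numeral simp_thms)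
  \<comment> \<open>A rational lower bound for \<open>exp (11 / 6)\<close>, about 6.25, from the
    eighth power of a quadratic Taylor bound.\<close>
  have "(6.166::real) \<le> (1 + 11 / 48 + (11 / 48)\<^sup>2 / 2) ^ 8" by (simp add: power2_eq_square power_divide eval_nat_numeral)
  also have "\<dots> \<le> exp (11 / 48) ^ 8"
    by (intro power_mono exp_lower_Taylor_quadratic) auto
  also have "\<dots> = exp (11 / 6)" by (simp add: exp_of_nat_mult[symmetric])
  finally have e: "exp (- 11 / 6) \<le> 1 / (6.166::real)"
    by (simp add: exp_minus field_simps)
  have "?Q\<^sup>2 \<le> real N / 4 * (1 / 6.166)"
    using * mult_left_mono[OF e, of "real N / 4"] by linarith
  \<comment> \<open>From \<open>5 \<le> n\<close> follows \<open>N \<le> 6 / 5 * n\<close>, which is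
    just enough for the constant 15/68.\<close>
  also have "\<dots> \<le> (15 / 68)\<^sup>2 * real n"
    using assms by (simp add: N_def power2_eq_square)
  also have "\<dots> = (15 / 68 * sqrt (real n))\<^sup>2" by (simp add: power_mult_distrib power_divide)
  finally have "?Q \<le> 15 / 68 * sqrt (real n)"
    by (rule power2_le_imp_le) simp
  thus ?thesis by (simp add: j_def N_def mult_ac)
qed

text \<open>For \<open>n\<close> equal to 2, 3 or 4 every \<open>k\<close> is checked numerically,
  after squaring to remove the root. At \<open>n = k = 1\<close> the left side is 1/2, above 15/34,
  which is why a single sample is treated separately later.\<close>

lemma binomial_central_term_le:
  assumes "2 \<le> n" "1 \<le> k" "k \<le> n"
  shows "2 * (real k * real (n choose k) * (real k ^ k * real (n + 1 - k) ^ (n + 1 - k) / real (n + 1) ^ (n + 1)))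
          \<le> 15 / 34 * sqrt (real n)"
proof (cases "5 \<le> n")
  case True
  thus ?thesis using binomial_central_term_le_large assms by blast
next
  case False
  then consider "n = 2" | "n = 3" | "n = 4" using assms by linarith
  hence "(2 * (real k * real (n choose k) * (real k ^ k * real (n + 1 - k) ^ (n + 1 - k) / real (n + 1) ^ (n + 1))))\<^sup>2
      \<le> (15 / 34)\<^sup>2 * real n"
  proof cases
    case 1
    then consider "k = 1" | "k = 2" using assms by linarith
    thus ?thesis by cases (simp_all add: 1 eval_nat_numeral)
  next
    case 2
    then consider "k = 1" | "k = 2" | "k = 3" using assms by linarith
    thus ?thesis by cases (simp_all add: 2 eval_nat_numeral)
  next
    case 3
    then consider "k = 1" | "k = 2" | "k = 3" | "k = 4" using assms by linarith
    thus ?thesis by cases (simp_all add: 3 eval_nat_numeral)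
  qed
  also have "\<dots> = (15 / 34 * sqrt (real n))\<^sup>2" by (simp add: power_mult_distrib power_divide)
  finally show ?thesis by (rule power2_le_imp_le) simp
qed

text \<open>De Moivre: the summands telescope and change sign once, so the sum is twice the largest term.\<close>
lemma binomial_mean_abs_deviation_le:
  fixes p :: real
  assumes p: "0 \<le> p" "p \<le> 1" and n: "2 \<le> n"
  shows "(\<Sum>k\<le>n. real (n choose k) * p ^ k * (1 - p) ^ (n - k) * \<bar>real k - real n * p\<bar>)
      \<le> 15 / 34 * sqrt (real n)"
proof -
  \<comment> \<open>Without the absolute value each summand is \<open>T k - T (Suc k)\<close>, and
    \<open>T\<close> vanishes at \<open>0\<close> and at \<open>n + 1\<close>.\<close>
  define T where "T k = real k * real (n choose k) * p ^ k * (1 - p) ^ (n + 1 - k)" for k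
  have step: "real (n choose k) * p ^ k * (1 - p) ^ (n - k) * (real k - real n * p) = T k - T (Suc k)"
    if "k \<le> n" for k
  proof -
    have "real (Suc k) * real (n choose Suc k) = real (n - k) * real (n choose k)"
      using binomial_absorb_comp[of n k] Suc_times_binomial_eq[of "n-1" k] that
      by (metis binomial_absorption of_nat_mult)
    hence "T (Suc k) = real (n - k) * real (n choose k) * p ^ Suc k * (1 - p) ^ (n - k)"
      unfolding T_def by simp
    moreover have "(1 - p) ^ (n + 1 - k) = (1 - p) * (1 - p) ^ (n - k)"
      using that by (simp add: Suc_diff_le)
    ultimately show ?thesis using that
      by (simp only: T_def of_nat_diff power_Suc) (simp add: algebra_simps)
  qed
  have T: "T k \<le> 15 / 68 * sqrt (real n)" if "k \<le> n + 1" for k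
  proof (cases "k = 0 \<or> k = n + 1")
    case True
    hence "T k = 0" by (auto simp: T_def binomial_eq_0)
    thus ?thesis by simp
  next
    case False
    hence k: "1 \<le> k" "k \<le> n" using that by auto
    have "p ^ k * (1 - p) ^ (n + 1 - k) \<le> real k ^ k * real (n + 1 - k) ^ (n + 1 - k) / real (n + 1) ^ (n + 1)"
      using power_mult_power_le[of p "1 - p" k "n + 1 - k"] p k by simp
    hence "real k * real (n choose k) * (p ^ k * (1 - p) ^ (n + 1 - k))
        \<le> real k * real (n choose k) * (real k ^ k * real (n + 1 - k) ^ (n + 1 - k) / real (n + 1) ^ (n + 1))"
      by (intro mult_left_mono) auto
    thus ?thesis using binomial_central_term_le[OF n k] by (simp add: T_def mult.assoc)
  qed
  \<comment> \<open>While the indices stay below \<open>n * p\<close> the differences are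
    nonpositive and the absolute values sum to \<open>T i\<close>; afterwards they descend from a
    peak of at most \<open>15 / 68 * sqrt n\<close>. The threshold is \<open>n * p + 1\<close>
    because the last index summed is \<open>i - 1\<close>.\<close>
  have partial: "(\<Sum>k<i. \<bar>T k - T (Suc k)\<bar>) \<le> (if real i \<le> real n * p + 1 then T i else 2 * (15 / 68 * sqrt (real n)) - T i)"
    if "i \<le> n + 1" for i
    using that
  proof (induction i)
    case 0
    show ?case using p by (simp add: T_def)
  next
    case (Suc i)
    have i: "i \<le> n" using Suc by simp
    have w: "0 \<le> real (n choose i) * p ^ i * (1 - p) ^ (n - i)" using p by simp
    show ?case
    proof (cases "real i \<le> real n * p")
      case True
      have "T i - T (Suc i) \<le> 0" unfolding step[OF i, symmetric]
        by (rule mult_nonneg_nonpos[OF w]) (use True in simp)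
      thus ?thesis using Suc True by simp
    next
      case False
      have "0 \<le> T i - T (Suc i)" unfolding step[OF i, symmetric]
        by (rule mult_nonneg_nonneg[OF w]) (use False in simp)
      thus ?thesis using Suc False T[of i] by (auto split: if_splits)
    qed
  qed
  have "(\<Sum>k\<le>n. real (n choose k) * p ^ k * (1 - p) ^ (n - k) * \<bar>real k - real n * p\<bar>)
      = (\<Sum>k\<le>n. \<bar>T k - T (Suc k)\<bar>)"
    using p by (intro sum.cong refl) (simp add: step[symmetric] abs_mult)
  also have "\<dots> = (\<Sum>k<n + 1. \<bar>T k - T (Suc k)\<bar>)" by (simp add: lessThan_Suc_atMost)
  also have "\<dots> \<le> 15 / 34 * sqrt (real n)"
  proof -
    have "T (n + 1) = 0" by (simp add: T_def binomial_eq_0)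
    moreover have "0 \<le> sqrt (real n)" by simp
    ultimately have "(if real (n + 1) \<le> real n * p + 1 then T (n + 1)
        else 2 * (15 / 68 * sqrt (real n)) - T (n + 1)) \<le> 15 / 34 * sqrt (real n)" by simp
    thus ?thesis using partial[OF order_refl] by (rule order_trans[rotated])
  qed
  finally show ?thesis .
qed

section \<open>McDiarmid's inequality\<close>

text \<open>Pascal's rule, in the form that splits a binomial expectation according to the outcome
  of one trial.\<close>

lemma sum_binomial_Suc:
  fixes h :: "nat \<Rightarrow> real"
  shows "(\<Sum>k\<le>Suc n. real (Suc n choose k) * h k) = (\<Sum>k\<le>n. real (n choose k) * (h k + h (Suc k)))"
proof -
  have "(\<Sum>k\<le>Suc n. real (Suc n choose k) * h k)
      = h 0 + (\<Sum>k\<le>n. real (n choose k) * h (Suc k)) + (\<Sum>k\<le>n. real (n choose Suc k) * h (Suc k))"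
    by (simp add: sum.atMost_Suc_shift sum.distrib algebra_simps del: sum.atMost_Suc)
  also have "h 0 + (\<Sum>k\<le>n. real (n choose Suc k) * h (Suc k)) = (\<Sum>k\<le>Suc n. real (n choose k) * h k)"
    by (simp add: sum.atMost_Suc_shift del: sum.atMost_Suc)
  hence "(\<Sum>k\<le>n. real (n choose Suc k) * h (Suc k)) = (\<Sum>k\<le>n. real (n choose k) * h k) - h 0"
    by (simp add: binomial_eq_0)
  finally show ?thesis by (simp add: sum.distrib algebra_simps)
qed

lemma fun_upd_space_PiM_lessThan:
  assumes "S \<in> space (PiM {..<n} (\<lambda>_. D))" "z \<in> space D"
  shows "S(n := z) \<in> space (PiM {..<Suc n} (\<lambda>_. D))"
  using assms by (auto simp: space_PiM PiE_iff extensional_def)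

lemma fun_upd_space_PiM_same:
  assumes "S \<in> space (PiM {..<n} (\<lambda>_. D))" "z \<in> space D" "i < n"
  shows "S(i := z) \<in> space (PiM {..<n} (\<lambda>_. D))"
  using assms by (auto simp: space_PiM PiE_iff extensional_def)

text \<open>Induction on the number of coordinates. Averaging out the last one gives a function
  \<open>g\<close> with the same bound and the same differences, to which the induction hypothesis
  applies; Hoeffding's lemma for the last coordinate, the others being fixed, contributes one factor
  \<open>exp (t\<^sup>2 * c\<^sup>2 / 8)\<close>.\<close>

lemma bounded_difference_mgf_le:
  fixes f :: "(nat \<Rightarrow> 'z) \<Rightarrow> real"
  assumes D: "prob_space D" and t: "0 < t"
    and f: "f \<in> borel_measurable (PiM {..<n} (\<lambda>_. D))"
    and bdd: "\<And>S. S \<in> space (PiM {..<n} (\<lambda>_. D)) \<Longrightarrow> \<bar>f S\<bar> \<le> B"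
    and diff: "\<And>S i z. S \<in> space (PiM {..<n} (\<lambda>_. D)) \<Longrightarrow> i < n \<Longrightarrow> z \<in> space D \<Longrightarrow> \<bar>f (S(i := z)) - f S\<bar> \<le> c"
  shows "(\<integral>\<^sup>+S. ennreal (exp (t * (f S - (\<integral>S. f S \<partial>PiM {..<n} (\<lambda>_. D))))) \<partial>PiM {..<n} (\<lambda>_. D))
    \<le> ennreal (exp (real n * (t\<^sup>2 * c\<^sup>2 / 8)))"
  using f bdd diff
proof (induction n arbitrary: f)
  case 0
  show ?case by (simp add: lessThan_0 PiM_empty nn_integral_count_space_finite lebesgue_integral_count_space_finite)
next
  case (Suc n)
  interpret D: prob_space D by (rule D)
  interpret PS: product_prob_space "\<lambda>_. D" "{..<Suc n}" by unfold_locales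
  interpret product_sigma_finite "\<lambda>_. D" by unfold_locales
  let ?P = "PiM {..<n} (\<lambda>_. D)" and ?Q = "PiM {..<Suc n} (\<lambda>_. D)"
  have ins: "{..<Suc n} = insert n {..<n}" by auto
  note [measurable] = Suc.prems(1)
  have upd[measurable]: "(\<lambda>(S, z). S(n := z)) \<in> measurable (?P \<Otimes>\<^sub>M D) ?Q"
    unfolding ins by measurable
  have fm[measurable]: "(\<lambda>(S, z). f (S(n := z))) \<in> borel_measurable (?P \<Otimes>\<^sub>M D)"
    using measurable_comp[OF upd Suc.prems(1)] by (simp add: comp_def case_prod_beta')
  have int: "integrable ?Q f"
    by (rule PS.integrable_const_bound[of _ B]) (use Suc.prems in auto)
  have fz[measurable]: "(\<lambda>z. f (S(n := z))) \<in> borel_measurable D" if "S \<in> space ?P" for S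
    using measurable_compose[OF measurable_Pair1'[OF that] fm] by simp
  have intz: "integrable D (\<lambda>z. f (S(n := z)))" if "S \<in> space ?P" for S
    by (rule D.integrable_const_bound[of _ B] AE_I2)+
       (use that Suc.prems(2) fun_upd_space_PiM_lessThan[OF that] fz in auto)
  define g where "g S = (\<integral>z. f (S(n := z)) \<partial>D)" for S
  have g[measurable]: "g \<in> borel_measurable ?P"
    unfolding g_def by measurable
  have gB: "\<bar>g S\<bar> \<le> B" if "S \<in> space ?P" for S
  proof -
    have "norm (g S) \<le> (\<integral>z. norm (f (S(n := z))) \<partial>D)" unfolding g_def by (rule integral_norm_bound)
    also have "\<dots> \<le> B"
      by (intro D.integral_le_const AE_I2 integrable_norm intz that)
         (use Suc.prems(2) fun_upd_space_PiM_lessThan[OF that] in auto)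
    finally show ?thesis by simp
  qed
  have gd: "\<bar>g (S(i := w)) - g S\<bar> \<le> c" if S: "S \<in> space ?P" and i: "i < n" and w: "w \<in> space D" for S i w
  proof -
    have S': "S(i := w) \<in> space ?P" using fun_upd_space_PiM_same[OF S w i] .
    have "g (S(i := w)) - g S = (\<integral>z. f (S(i := w, n := z)) - f (S(n := z)) \<partial>D)"
      unfolding g_def by (rule Bochner_Integration.integral_diff[symmetric]) (use intz S S' in auto)
    also have "norm \<dots> \<le> (\<integral>z. norm (f (S(i := w, n := z)) - f (S(n := z))) \<partial>D)" by (rule integral_norm_bound)
    also have "\<dots> \<le> c"
    proof (rule D.integral_le_const)
      show "integrable D (\<lambda>z. norm (f (S(i := w, n := z)) - f (S(n := z))))"
        by (intro integrable_norm Bochner_Integration.integrable_diff intz S S')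
      show "AE z in D. norm (f (S(i := w, n := z)) - f (S(n := z))) \<le> c"
      proof (rule AE_I2)
        fix z assume z: "z \<in> space D"
        have "S(i := w, n := z) = S(n := z, i := w)" using i by (simp add: fun_upd_twist)
        moreover have "\<bar>f (S(n := z, i := w)) - f (S(n := z))\<bar> \<le> c"
          by (rule Suc.prems(3)[OF fun_upd_space_PiM_lessThan[OF S z]]) (use i w in auto)
        ultimately show "norm (f (S(i := w, n := z)) - f (S(n := z))) \<le> c"
          by (simp only: real_norm_def)
      qed
    qed
    finally show ?thesis by simp
  qed
  have Eg: "(\<integral>S. f S \<partial>?Q) = (\<integral>S. g S \<partial>?P)"
    using product_integral_insert[of "{..<n}" n f] int by (simp add: ins g_def)
  let ?E = "\<integral>S. g S \<partial>?P" and ?C = "exp (t\<^sup>2 * c\<^sup>2 / 8)"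
  have inner: "(\<integral>\<^sup>+z. ennreal (exp (t * (f (S(n := z)) - ?E))) \<partial>D) \<le> ennreal (exp (t * (g S - ?E))) * ennreal ?C"
    if S: "S \<in> space ?P" for S
  proof -
    \<comment> \<open>Any two values of the section differ by at most \<open>c\<close>, so all of
      them lie in an interval of length \<open>c\<close> that starts at their infimum.\<close>
    define a where "a = (INF z\<in>space D. f (S(n := z)))"
    have ne: "space D \<noteq> {}" by (rule D.not_empty)
    have bb: "bdd_below ((\<lambda>z. f (S(n := z))) ` space D)"
      using Suc.prems(2) fun_upd_space_PiM_lessThan[OF S] by (intro bdd_belowI[of _ "-B"]) (fastforce simp: abs_le_iff)
    interpret iv: interval_bounded_random_variable D "\<lambda>z. f (S(n := z))" a "a + c"
    proof
      show "(\<lambda>z. f (S(n := z))) \<in> borel_measurable D" using fz S by simp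
      show "AE z in D. f (S(n := z)) \<in> {a..a + c}"
      proof (rule AE_I2)
        fix z assume z: "z \<in> space D"
        have "a \<le> f (S(n := z))" unfolding a_def by (rule cINF_lower[OF bb z])
        moreover have "f (S(n := z)) - c \<le> a" unfolding a_def
        proof (rule cINF_greatest[OF ne])
          fix w assume w: "w \<in> space D"
          have "\<bar>f (S(n := w, n := z)) - f (S(n := w))\<bar> \<le> c"
            by (rule Suc.prems(3)[OF fun_upd_space_PiM_lessThan[OF S w]]) (use z in auto)
          thus "f (S(n := z)) - c \<le> f (S(n := w))" by simp
        qed
        ultimately show "f (S(n := z)) \<in> {a..a + c}" by simp
      qed
    qed
    have H: "(\<integral>\<^sup>+z. ennreal (exp (t * (f (S(n := z)) - g S))) \<partial>D) \<le> ennreal ?C"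
      using iv.Hoeffdings_lemma_nn_integral[OF t] by (simp add: g_def)
    have "(\<integral>\<^sup>+z. ennreal (exp (t * (f (S(n := z)) - ?E))) \<partial>D)
        = (\<integral>\<^sup>+z. ennreal (exp (t * (g S - ?E))) * ennreal (exp (t * (f (S(n := z)) - g S))) \<partial>D)"
      by (intro nn_integral_cong) (simp add: ennreal_mult[symmetric] exp_add[symmetric] algebra_simps)
    also have "\<dots> = ennreal (exp (t * (g S - ?E))) * (\<integral>\<^sup>+z. ennreal (exp (t * (f (S(n := z)) - g S))) \<partial>D)"
      using fz[OF S] by (intro nn_integral_cmult) measurable
    also have "\<dots> \<le> ennreal (exp (t * (g S - ?E))) * ennreal ?C" by (intro mult_left_mono H) simp
    finally show ?thesis .
  qed
  have "(\<integral>\<^sup>+S. ennreal (exp (t * (f S - ?E))) \<partial>?Q)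
      = (\<integral>\<^sup>+S. \<integral>\<^sup>+z. ennreal (exp (t * (f (S(n := z)) - ?E))) \<partial>D \<partial>?P)"
    unfolding ins by (subst product_nn_integral_insert) (auto simp: ins[symmetric])
  also have "\<dots> \<le> (\<integral>\<^sup>+S. ennreal (exp (t * (g S - ?E))) * ennreal ?C \<partial>?P)"
    by (intro nn_integral_mono inner)
  also have "\<dots> = (\<integral>\<^sup>+S. ennreal (exp (t * (g S - ?E))) \<partial>?P) * ennreal ?C"
    by (rule nn_integral_multc) measurable
  also have "\<dots> \<le> ennreal (exp (real n * (t\<^sup>2 * c\<^sup>2 / 8))) * ennreal ?C"
    by (intro mult_right_mono Suc.IH g gB gd) auto
  also have "\<dots> = ennreal (exp (real (Suc n) * (t\<^sup>2 * c\<^sup>2 / 8)))"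
    by (simp add: ennreal_mult[symmetric] exp_add[symmetric] algebra_simps)
  finally show ?case unfolding Eg .
qed

theorem McDiarmid_inequality:
  fixes f :: "(nat \<Rightarrow> 'z) \<Rightarrow> real"
  assumes D: "prob_space D" and n: "0 < n" and c: "0 < c" and \<epsilon>: "0 < \<epsilon>"
    and f[measurable]: "f \<in> borel_measurable (PiM {..<n} (\<lambda>_. D))"
    and bdd: "\<And>S. S \<in> space (PiM {..<n} (\<lambda>_. D)) \<Longrightarrow> \<bar>f S\<bar> \<le> B"
    and diff: "\<And>S i z. S \<in> space (PiM {..<n} (\<lambda>_. D)) \<Longrightarrow> i < n \<Longrightarrow> z \<in> space D \<Longrightarrow> \<bar>f (S(i := z)) - f S\<bar> \<le> c"
  shows "measure (PiM {..<n} (\<lambda>_. D))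
      {S \<in> space (PiM {..<n} (\<lambda>_. D)). (\<integral>S. f S \<partial>PiM {..<n} (\<lambda>_. D)) + \<epsilon> \<le> f S}
    \<le> exp (- 2 * \<epsilon>\<^sup>2 / (real n * c\<^sup>2))"
proof -
  interpret D: prob_space D by (rule D)
  interpret PD: product_prob_space "\<lambda>_. D" "{..<n}" by unfold_locales
  let ?P = "PiM {..<n} (\<lambda>_. D)"
  let ?E = "\<integral>S. f S \<partial>?P"
  \<comment> \<open>The minimiser of the Chernoff exponent
    \<open>- t * \<epsilon> + n * t\<^sup>2 * c\<^sup>2 / 8\<close>.\<close>
  define t where "t = 4 * \<epsilon> / (real n * c\<^sup>2)"
  have t: "0 < t" using n c \<epsilon> by (simp add: t_def)
  have "{S \<in> space ?P. ?E + \<epsilon> \<le> f S}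
      = {S \<in> space ?P. 1 \<le> ennreal (exp (- t * \<epsilon>)) * ennreal (exp (t * (f S - ?E)))} \<inter> space ?P"
  proof -
    have "1 \<le> ennreal (exp (- t * \<epsilon>)) * ennreal (exp (t * (f S - ?E))) \<longleftrightarrow> ?E + \<epsilon> \<le> f S" for S
    proof -
      have "1 \<le> ennreal (exp (- t * \<epsilon>)) * ennreal (exp (t * (f S - ?E))) \<longleftrightarrow> 0 \<le> t * (f S - ?E - \<epsilon>)"
        by (simp add: ennreal_mult[symmetric] exp_add[symmetric] ennreal_1[symmetric] algebra_simps
            del: ennreal_1)
      also have "\<dots> \<longleftrightarrow> ?E + \<epsilon> \<le> f S" using t by (auto simp: zero_le_mult_iff)
      finally show ?thesis .
    qed
    thus ?thesis by auto
  qed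
  hence "emeasure ?P {S \<in> space ?P. ?E + \<epsilon> \<le> f S}
      \<le> ennreal (exp (- t * \<epsilon>)) * (\<integral>\<^sup>+S. ennreal (exp (t * (f S - ?E))) * indicator (space ?P) S \<partial>?P)"
    using nn_integral_Markov_inequality[of "\<lambda>S. ennreal (exp (t * (f S - ?E)))" "space ?P" ?P "ennreal (exp (- t * \<epsilon>))"]
    by (simp add: Int_def conj_ac)
  also have "\<dots> = ennreal (exp (- t * \<epsilon>)) * (\<integral>\<^sup>+S. ennreal (exp (t * (f S - ?E))) \<partial>?P)"
    by (intro arg_cong2[where f = "(*)"] nn_integral_cong) auto
  also have "\<dots> \<le> ennreal (exp (- t * \<epsilon>)) * ennreal (exp (real n * (t\<^sup>2 * c\<^sup>2 / 8)))"
    by (intro mult_left_mono bounded_difference_mgf_le[OF D t f bdd diff]) auto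
  also have "\<dots> = ennreal (exp (- 2 * \<epsilon>\<^sup>2 / (real n * c\<^sup>2)))"
  proof -
    have "- t * \<epsilon> + real n * (t\<^sup>2 * c\<^sup>2 / 8) = - 2 * \<epsilon>\<^sup>2 / (real n * c\<^sup>2)"
      using n c by (simp add: t_def field_simps power2_eq_square)
    thus ?thesis by (simp add: ennreal_mult[symmetric] exp_add[symmetric])
  qed
  finally show ?thesis by (simp add: PD.emeasure_eq_measure)
qed

section \<open>Centered sums of losses\<close>

context
  fixes D :: "'z measure" and u :: "'z \<Rightarrow> real" and p :: real
  assumes D: "prob_space D" and u[measurable]: "u \<in> borel_measurable D"
    and u01: "\<And>z. z \<in> space D \<Longrightarrow> 0 \<le> u z \<and> u z \<le> 1"
    and p: "p = (\<integral>z. u z \<partial>D)"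
begin

interpretation D: prob_space D by (rule D)

lemma integrable_unit_interval: "integrable D u"
  by (rule D.integrable_const_bound[of _ 1]) (use u01 u in auto)

lemma unit_mean: "0 \<le> p" "p \<le> 1"
  using u01 integrable_unit_interval unfolding p
  by (auto intro!: integral_nonneg_AE D.integral_le_const)

lemma abs_centered_sum_le:
  assumes "S \<in> space (PiM {..<n} (\<lambda>_. D))"
  shows "\<bar>b + (\<Sum>i<n. u (S i) - p)\<bar> \<le> \<bar>b\<bar> + real n"
proof -
  have "\<bar>\<Sum>i<n. u (S i) - p\<bar> \<le> (\<Sum>i<n. \<bar>u (S i) - p\<bar>)" by (rule sum_abs)
  also have "\<dots> \<le> (\<Sum>i<n. 1)"
  proof (rule sum_mono)
    fix i assume "i \<in> {..<n}"
    hence "S i \<in> space D" using assms by (auto simp: space_PiM)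
    thus "\<bar>u (S i) - p\<bar> \<le> 1" using u01[of "S i"] unit_mean by auto
  qed
  finally show ?thesis by simp
qed

lemma integral_affine_unit: "(\<integral>z. (1 - u z) * A + u z * B \<partial>D) = (1 - p) * A + p * B"
  using integrable_unit_interval by (simp add: p D.prob_space)

text \<open>Replacing the last variable by a Bernoulli variable of the same mean does not lower the
  expectation: \<open>f\<close> lies below its chord on unit intervals, and the chord is affine in
  \<open>u z\<close>, so only the mean \<open>p\<close> survives integration. The offset
  \<open>b\<close> collects the variables already replaced.\<close>

lemma integral_PiM_convex_step:
  fixes f :: "real \<Rightarrow> real"
  assumes f[measurable]: "f \<in> borel_measurable borel"
    and f0: "\<And>y. 0 \<le> f y"
    and bdd: "\<And>b. \<exists>B. \<forall>y. \<bar>y\<bar> \<le> b \<longrightarrow> \<bar>f y\<bar> \<le> B"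
    and conv: "\<And>y v. 0 \<le> v \<Longrightarrow> v \<le> 1 \<Longrightarrow> f (y + v) \<le> (1 - v) * f y + v * f (y + 1)"
  shows "(\<integral>S. f (b + (\<Sum>i<Suc n. u (S i) - p)) \<partial>PiM {..<Suc n} (\<lambda>_. D))
    \<le> (1 - p) * (\<integral>S. f ((b - p) + (\<Sum>i<n. u (S i) - p)) \<partial>PiM {..<n} (\<lambda>_. D))
      + p * (\<integral>S. f ((b + 1 - p) + (\<Sum>i<n. u (S i) - p)) \<partial>PiM {..<n} (\<lambda>_. D))"
proof -
  interpret product_sigma_finite "\<lambda>_. D" by unfold_locales
  have ins: "{..<Suc n} = insert n {..<n}" by auto
  let ?s = "\<lambda>S :: nat \<Rightarrow> 'z. \<Sum>i<n. u (S i) - p"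
  have int: "integrable (PiM {..<k} (\<lambda>_. D)) (\<lambda>S. f (b + (\<Sum>i<k. u (S i) - p)))" for b and k :: nat
  proof -
    interpret PD: product_prob_space "\<lambda>_. D" "{..<k}" by unfold_locales
    obtain B where "\<forall>y. \<bar>y\<bar> \<le> \<bar>b\<bar> + real k \<longrightarrow> \<bar>f y\<bar> \<le> B" using bdd by blast
    thus ?thesis
      by (intro PD.integrable_const_bound[of _ B]) (use abs_centered_sum_le in auto)
  qed
  have "(\<integral>S. f (b + (\<Sum>i<Suc n. u (S i) - p)) \<partial>PiM {..<Suc n} (\<lambda>_. D))
      = (\<integral>S. \<integral>z. f (b + (\<Sum>i<Suc n. u ((S(n := z)) i) - p)) \<partial>D \<partial>PiM {..<n} (\<lambda>_. D))"
    using product_integral_insert[of "{..<n}" n "\<lambda>S. f (b + (\<Sum>i<Suc n. u (S i) - p))"] int[of "Suc n" b]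
    unfolding ins[symmetric] by simp
  also have "\<dots> = (\<integral>S. \<integral>z. f (b + ?s S + (u z - p)) \<partial>D \<partial>PiM {..<n} (\<lambda>_. D))"
    by (simp add: algebra_simps)
  also have "\<dots> \<le> (\<integral>S. (1 - p) * f ((b - p) + ?s S) + p * f ((b + 1 - p) + ?s S) \<partial>PiM {..<n} (\<lambda>_. D))"
  proof (rule integral_mono_AE')
    show "integrable (PiM {..<n} (\<lambda>_. D)) (\<lambda>S. (1 - p) * f ((b - p) + ?s S) + p * f ((b + 1 - p) + ?s S))"
      using int by auto
    show "AE S in PiM {..<n} (\<lambda>_. D). 0 \<le> (1 - p) * f ((b - p) + ?s S) + p * f ((b + 1 - p) + ?s S)"
      using unit_mean f0 by simp
    show "AE S in PiM {..<n} (\<lambda>_. D). (\<integral>z. f (b + ?s S + (u z - p)) \<partial>D)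
        \<le> (1 - p) * f ((b - p) + ?s S) + p * f ((b + 1 - p) + ?s S)"
    proof (rule AE_I2)
      fix S :: "nat \<Rightarrow> 'z"
      let ?y = "(b - p) + ?s S"
      have "(\<integral>z. f (b + ?s S + (u z - p)) \<partial>D) \<le> (\<integral>z. (1 - u z) * f ?y + u z * f (?y + 1) \<partial>D)"
      proof (rule integral_mono_AE')
        show "integrable D (\<lambda>z. (1 - u z) * f ?y + u z * f (?y + 1))"
          using integrable_unit_interval by auto
        have "f (b + ?s S + (u z - p)) \<le> (1 - u z) * f ?y + u z * f (?y + 1)" if "z \<in> space D" for z
          using conv[of "u z" ?y] u01[OF that] by (simp add: algebra_simps)
        thus "AE z in D. f (b + ?s S + (u z - p)) \<le> (1 - u z) * f ?y + u z * f (?y + 1)" by (rule AE_I2)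
        show "AE z in D. 0 \<le> (1 - u z) * f ?y + u z * f (?y + 1)"
          using u01 f0 by (intro AE_I2) (auto intro!: add_nonneg_nonneg)
      qed
      thus "(\<integral>z. f (b + ?s S + (u z - p)) \<partial>D)
          \<le> (1 - p) * f ((b - p) + ?s S) + p * f ((b + 1 - p) + ?s S)"
        unfolding integral_affine_unit by (simp add: algebra_simps)
    qed
  qed
  also have "\<dots> = (1 - p) * (\<integral>S. f ((b - p) + ?s S) \<partial>PiM {..<n} (\<lambda>_. D))
      + p * (\<integral>S. f ((b + 1 - p) + ?s S) \<partial>PiM {..<n} (\<lambda>_. D))"
    using int by simp
  finally show ?thesis .
qed

text \<open>All variables are replaced by Bernoulli variables one at a time, which leaves a binomial
  expectation; Pascal's rule recombines the two branches. The induction needs arbitrary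
  \<open>b\<close>.\<close>

lemma centered_sum_abs_le_binomial:
  "(\<integral>S. \<bar>b + (\<Sum>i<n. u (S i) - p)\<bar> \<partial>PiM {..<n} (\<lambda>_. D))
    \<le> (\<Sum>k\<le>n. real (n choose k) * (p ^ k * (1 - p) ^ (n - k) * \<bar>b + real k - real n * p\<bar>))"
proof (induction n arbitrary: b)
  case 0
  show ?case by (simp add: lessThan_0 PiM_empty lebesgue_integral_count_space_finite)
next
  case (Suc n)
  let ?h = "\<lambda>k. p ^ k * (1 - p) ^ (Suc n - k) * \<bar>b + real k - real (Suc n) * p\<bar>"
  have "(\<integral>S. \<bar>b + (\<Sum>i<Suc n. u (S i) - p)\<bar> \<partial>PiM {..<Suc n} (\<lambda>_. D))
      \<le> (1 - p) * (\<integral>S. \<bar>(b - p) + (\<Sum>i<n. u (S i) - p)\<bar> \<partial>PiM {..<n} (\<lambda>_. D))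
      + p * (\<integral>S. \<bar>(b + 1 - p) + (\<Sum>i<n. u (S i) - p)\<bar> \<partial>PiM {..<n} (\<lambda>_. D))"
  proof (rule integral_PiM_convex_step)
    fix y v :: real assume v: "0 \<le> v" "v \<le> 1"
    have "y + v = (1 - v) * y + v * (y + 1)" by (simp add: algebra_simps)
    hence "\<bar>y + v\<bar> \<le> \<bar>(1 - v) * y\<bar> + \<bar>v * (y + 1)\<bar>" by (metis abs_triangle_ineq)
    thus "\<bar>y + v\<bar> \<le> (1 - v) * \<bar>y\<bar> + v * \<bar>y + 1\<bar>" using v by (simp add: abs_mult)
  qed auto
  also have "\<dots> \<le> (1 - p) * (\<Sum>k\<le>n. real (n choose k) * (p ^ k * (1 - p) ^ (n - k) * \<bar>(b - p) + real k - real n * p\<bar>))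
      + p * (\<Sum>k\<le>n. real (n choose k) * (p ^ k * (1 - p) ^ (n - k) * \<bar>(b + 1 - p) + real k - real n * p\<bar>))"
    using unit_mean by (intro add_mono mult_left_mono Suc.IH) auto
  also have "\<dots> = (\<Sum>k\<le>n. real (n choose k) * (?h k + ?h (Suc k)))"
    unfolding sum_distrib_left sum.distrib[symmetric]
  proof (rule sum.cong[OF refl])
    fix k assume "k \<in> {..n}"
    hence "(1 - p) ^ (Suc n - k) = (1 - p) * (1 - p) ^ (n - k)" by (simp add: Suc_diff_le)
    moreover have "b + real k - real (Suc n) * p = (b - p) + real k - real n * p"
      "b + real (Suc k) - real (Suc n) * p = (b + 1 - p) + real k - real n * p"
      by (simp_all add: algebra_simps)
    ultimately show "(1 - p) * (real (n choose k) * (p ^ k * (1 - p) ^ (n - k) * \<bar>(b - p) + real k - real n * p\<bar>))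
        + p * (real (n choose k) * (p ^ k * (1 - p) ^ (n - k) * \<bar>(b + 1 - p) + real k - real n * p\<bar>))
        = real (n choose k) * (?h k + ?h (Suc k))"
      by (simp only: diff_Suc_Suc power_Suc) (simp only: ring_distribs mult_ac)
  qed
  also have "\<dots> = (\<Sum>k\<le>Suc n. real (Suc n choose k) * ?h k)"
    by (rule sum_binomial_Suc[symmetric])
  finally show ?case .
qed

text \<open>The same replacement for the square; the right side is the exact second moment in the
  Bernoulli case.\<close>

lemma centered_sum_square_le:
  "(\<integral>S. (b + (\<Sum>i<n. u (S i) - p))\<^sup>2 \<partial>PiM {..<n} (\<lambda>_. D)) \<le> b\<^sup>2 + real n * (p * (1 - p))"
proof (induction n arbitrary: b)
  case 0
  show ?case by (simp add: lessThan_0 PiM_empty lebesgue_integral_count_space_finite)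
next
  case (Suc n)
  have "(\<integral>S. (b + (\<Sum>i<Suc n. u (S i) - p))\<^sup>2 \<partial>PiM {..<Suc n} (\<lambda>_. D))
      \<le> (1 - p) * (\<integral>S. ((b - p) + (\<Sum>i<n. u (S i) - p))\<^sup>2 \<partial>PiM {..<n} (\<lambda>_. D))
      + p * (\<integral>S. ((b + 1 - p) + (\<Sum>i<n. u (S i) - p))\<^sup>2 \<partial>PiM {..<n} (\<lambda>_. D))"
  proof (rule integral_PiM_convex_step)
    fix y v :: real assume v: "0 \<le> v" "v \<le> 1"
    have "v * v \<le> v" using v by (simp add: mult_left_le)
    thus "(y + v)\<^sup>2 \<le> (1 - v) * y\<^sup>2 + v * (y + 1)\<^sup>2" by (simp add: power2_eq_square algebra_simps)
  next
    fix b :: real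
    have "\<bar>y\<^sup>2\<bar> \<le> b\<^sup>2" if "\<bar>y\<bar> \<le> b" for y using that by (simp add: abs_le_square_iff[symmetric])
    thus "\<exists>B. \<forall>y. \<bar>y\<bar> \<le> b \<longrightarrow> \<bar>y\<^sup>2\<bar> \<le> B" by blast
  qed auto
  also have "\<dots> \<le> (1 - p) * ((b - p)\<^sup>2 + real n * (p * (1 - p))) + p * ((b + 1 - p)\<^sup>2 + real n * (p * (1 - p)))"
    using unit_mean by (intro add_mono mult_left_mono Suc.IH) auto
  also have "\<dots> = b\<^sup>2 + real (Suc n) * (p * (1 - p))"
    by (simp add: power2_eq_square algebra_simps)
  finally show ?case .
qed

end

section \<open>Change of measure\<close>

lemma dens_nonneg: "0 \<le> dens P \<eta> g"
  by (simp add: dens_def)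

lemma dens_measurable [measurable]: "dens P \<eta> \<in> borel_measurable P"
  unfolding dens_def by measurable

context
  fixes P \<eta> :: "'h measure"
  assumes P: "prob_space P" and \<eta>: "prob_space \<eta>" and sets_eq: "sets \<eta> = sets P"
    and ac: "absolutely_continuous P \<eta>"
begin

interpretation P: prob_space P by (rule P)
interpretation \<eta>: prob_space \<eta> by (rule \<eta>)

text \<open>The Radon-Nikodym derivative is finite almost everywhere, so passing to real values
  loses nothing.\<close>

lemma density_dens: "density P (\<lambda>g. ennreal (dens P \<eta> g)) = \<eta>"
proof -
  have "AE g in P. RN_deriv P \<eta> g \<noteq> \<infinity>"
    by (rule P.RN_deriv_finite) (use ac sets_eq in \<open>auto simp: \<eta>.sigma_finite_measure_axioms\<close>)
  hence "AE g in P. ennreal (dens P \<eta> g) = RN_deriv P \<eta> g"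
    by eventually_elim (simp add: dens_def less_top)
  hence "density P (\<lambda>g. ennreal (dens P \<eta> g)) = density P (RN_deriv P \<eta>)"
    by (intro density_cong) auto
  also have "\<dots> = \<eta>" by (rule P.density_RN_deriv[OF ac sets_eq])
  finally show ?thesis .
qed

lemma integral_eq_integral_dens:
  fixes v :: "'h \<Rightarrow> real"
  assumes "v \<in> borel_measurable P"
  shows "(\<integral>g. v g \<partial>\<eta>) = (\<integral>g. dens P \<eta> g * v g \<partial>P)"
  using integral_density[of v P "dens P \<eta>"] assms
  by (simp add: density_dens dens_nonneg)

lemma integrable_dens_mult:
  fixes v :: "'h \<Rightarrow> real"
  assumes v[measurable]: "v \<in> borel_measurable P" and B: "\<And>g. g \<in> space P \<Longrightarrow> \<bar>v g\<bar> \<le> B"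
  shows "integrable P (\<lambda>g. dens P \<eta> g * v g)"
proof -
  have "integrable \<eta> v"
    by (rule \<eta>.integrable_const_bound[of _ B])
       (use B sets_eq_imp_space_eq[OF sets_eq] v in \<open>auto simp: measurable_cong_sets[OF sets_eq refl]\<close>)
  thus ?thesis
    using integrable_density[of v P "dens P \<eta>"] v by (simp add: density_dens dens_nonneg)
qed

lemma integrable_dens: "integrable P (dens P \<eta>)"
  using integrable_dens_mult[of "\<lambda>_. 1" 1] by simp

lemma integral_dens: "(\<integral>g. dens P \<eta> g \<partial>P) = 1"
  using integral_eq_integral_dens[of "\<lambda>_. 1"] by (simp add: \<eta>.prob_space)

lemma integrable_sqrt_dens: "integrable P (\<lambda>g. sqrt (dens P \<eta> g))"
proof (rule Bochner_Integration.integrable_bound)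
  show "integrable P (\<lambda>g. 1 + dens P \<eta> g)" using integrable_dens by simp
  have "sqrt x \<le> 1 + x" if "0 \<le> x" for x :: real
    by (rule real_le_lsqrt) (use that in \<open>auto simp: power2_eq_square algebra_simps\<close>)
  thus "AE g in P. norm (sqrt (dens P \<eta> g)) \<le> norm (1 + dens P \<eta> g)"
    by (simp add: dens_nonneg)
qed measurable

lemma integrable_hellinger: "integrable P (\<lambda>g. (sqrt (dens P \<eta> g) - 1)\<^sup>2)"
proof -
  have "(sqrt (dens P \<eta> g) - 1)\<^sup>2 = dens P \<eta> g - 2 * sqrt (dens P \<eta> g) + 1" for g
    using dens_nonneg[of P \<eta> g] by (simp add: power2_diff)
  thus ?thesis using integrable_dens integrable_sqrt_dens by simp
qed

lemma hellinger2_eq: "hellinger2 \<eta> P = ereal (\<integral>g. (sqrt (dens P \<eta> g) - 1)\<^sup>2 \<partial>P)"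
  using ac integrable_hellinger by (simp add: hellinger2_def nn_integral_eq_integral)

lemma TV_eq: "TV \<eta> P = ereal (\<integral>g. \<bar>dens P \<eta> g - 1\<bar> / 2 \<partial>P)"
  using ac integrable_dens by (simp add: TV_def nn_integral_eq_integral)

text \<open>With \<open>s\<close> the root of the density, right minus left integrand is the square
  \<open>((1 - v) * s - 1)\<^sup>2 / (1 - v)\<close>. The bound \<open>c < 1\<close> keeps
  \<open>v / (1 - v)\<close> bounded, hence integrable.\<close>

lemma hellinger_change_of_measure_aux:
  fixes v :: "'h \<Rightarrow> real"
  assumes v[measurable]: "v \<in> borel_measurable P"
    and B: "\<And>g. g \<in> space P \<Longrightarrow> - B \<le> v g" and c: "\<And>g. g \<in> space P \<Longrightarrow> v g \<le> c" "c < 1"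
  shows "(\<integral>g. v g \<partial>\<eta>) \<le> (\<integral>g. (sqrt (dens P \<eta> g) - 1)\<^sup>2 \<partial>P) + (\<integral>g. v g / (1 - v g) \<partial>P)"
proof -
  have vb: "\<bar>v g\<bar> \<le> max B \<bar>c\<bar>" if "g \<in> space P" for g using B[OF that] c(1)[OF that] by auto
  have int: "integrable P (\<lambda>g. v g / (1 - v g))"
  proof (rule P.integrable_const_bound)
    show "AE g in P. norm (v g / (1 - v g)) \<le> max B \<bar>c\<bar> / (1 - c)"
    proof (rule AE_I2)
      fix g assume g: "g \<in> space P"
      show "norm (v g / (1 - v g)) \<le> max B \<bar>c\<bar> / (1 - c)"
        unfolding real_norm_def abs_divide
        by (rule frac_le) (use vb[OF g] c(1)[OF g] c(2) in auto)
    qed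
  qed measurable
  have "(\<integral>g. v g \<partial>\<eta>) = (\<integral>g. dens P \<eta> g * v g \<partial>P)" by (rule integral_eq_integral_dens[OF v])
  also have "\<dots> \<le> (\<integral>g. (sqrt (dens P \<eta> g) - 1)\<^sup>2 + v g / (1 - v g) \<partial>P)"
  proof (rule integral_mono)
    show "integrable P (\<lambda>g. dens P \<eta> g * v g)" by (rule integrable_dens_mult[OF v vb])
    show "integrable P (\<lambda>g. (sqrt (dens P \<eta> g) - 1)\<^sup>2 + v g / (1 - v g))"
      using integrable_hellinger int by simp
    fix g assume g: "g \<in> space P"
    define s where "s = sqrt (dens P \<eta> g)"
    have w: "0 < 1 - v g" using c(1)[OF g] c(2) by simp
    have "(s - 1)\<^sup>2 + v g / (1 - v g) - s\<^sup>2 * v g = ((1 - v g) * s - 1)\<^sup>2 / (1 - v g)"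
      using w by (simp add: field_simps power2_eq_square)
    also have "\<dots> \<ge> 0" using w by simp
    finally show "dens P \<eta> g * v g \<le> (sqrt (dens P \<eta> g) - 1)\<^sup>2 + v g / (1 - v g)"
      unfolding s_def by (simp add: dens_nonneg)
  qed
  also have "\<dots> = (\<integral>g. (sqrt (dens P \<eta> g) - 1)\<^sup>2 \<partial>P) + (\<integral>g. v g / (1 - v g) \<partial>P)"
    using integrable_hellinger int by simp
  finally show ?thesis .
qed

text \<open>As the density has mean 1 under \<open>P\<close>, subtracting
  \<open>(dens P \<eta> g - 1) / 2\<close> changes no integral. It centers \<open>x\<close> at 1/2,
  where its absolute value is at most 1/2, and this yields the factor 1/2 of total
  variation.\<close>

lemma TV_change_of_measure_aux:
  fixes x :: "'h \<Rightarrow> real"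
  assumes x[measurable]: "x \<in> borel_measurable P"
    and x01: "\<And>g. g \<in> space P \<Longrightarrow> 0 \<le> x g \<and> x g \<le> 1"
  shows "(\<integral>g. x g \<partial>\<eta>) \<le> (\<integral>g. \<bar>dens P \<eta> g - 1\<bar> / 2 \<partial>P) + (\<integral>g. x g \<partial>P)"
proof -
  have int: "integrable P x"
    by (rule P.integrable_const_bound[of _ 1]) (use x01 in auto)
  have intd: "integrable P (\<lambda>g. dens P \<eta> g * x g)"
    by (rule integrable_dens_mult[OF x, of 1]) (use x01 in auto)
  have "(\<integral>g. x g \<partial>\<eta>) - (\<integral>g. x g \<partial>P) = (\<integral>g. dens P \<eta> g * x g - x g - (dens P \<eta> g - 1) / 2 \<partial>P)"
    using int intd integrable_dens by (simp add: integral_eq_integral_dens[OF x] integral_dens P.prob_space)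
  also have "\<dots> \<le> (\<integral>g. \<bar>dens P \<eta> g - 1\<bar> / 2 \<partial>P)"
  proof (rule integral_mono)
    show "integrable P (\<lambda>g. dens P \<eta> g * x g - x g - (dens P \<eta> g - 1) / 2)"
      using int intd integrable_dens by simp
    show "integrable P (\<lambda>g. \<bar>dens P \<eta> g - 1\<bar> / 2)" using integrable_dens by simp
    fix g assume g: "g \<in> space P"
    have "dens P \<eta> g * x g - x g - (dens P \<eta> g - 1) / 2 = (dens P \<eta> g - 1) * (x g - 1 / 2)"
      by (simp add: field_simps)
    also have "\<dots> \<le> \<bar>dens P \<eta> g - 1\<bar> * \<bar>x g - 1 / 2\<bar>" by (metis abs_ge_self abs_mult)
    also have "\<dots> \<le> \<bar>dens P \<eta> g - 1\<bar> * (1 / 2)"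
    proof (rule mult_left_mono)
      show "\<bar>x g - 1 / 2\<bar> \<le> 1 / 2" using x01[OF g] by linarith
    qed simp
    finally show "dens P \<eta> g * x g - x g - (dens P \<eta> g - 1) / 2 \<le> \<bar>dens P \<eta> g - 1\<bar> / 2" by simp
  qed
  finally show ?thesis by simp
qed

text \<open>The integrated form of \<open>- ln f \<ge> 2 (1 - \<surd>f)\<close>, with positive and negative parts
  moved so that no subtraction occurs.\<close>
lemma hellinger2_le_revKL_aux: "hellinger2 \<eta> P \<le> revKL \<eta> P"
proof -
  let ?f = "dens P \<eta>"
  let ?p = "\<lambda>g. e2ennreal (max 0 (neg_ln (?f g)))" and ?n = "\<lambda>g. e2ennreal (max 0 (- neg_ln (?f g)))"
  let ?q = "\<lambda>g. 2 * (1 - sqrt (?f g))"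
  have p_eq: "?p g = (if ?f g \<le> 0 then \<infinity> else ennreal (- ln (?f g)))" for g
    by (auto simp: neg_ln_def e2ennreal_ereal max_def zero_ereal_def ennreal_neg)
  have n_eq: "?n g = (if ?f g \<le> 0 then 0 else ennreal (ln (?f g)))" for g
    by (auto simp: neg_ln_def e2ennreal_ereal max_def zero_ereal_def ennreal_neg)
  have pm[measurable]: "?p \<in> borel_measurable P" unfolding p_eq by measurable
  have nm[measurable]: "?n \<in> borel_measurable P" unfolding n_eq by measurable
  have pointwise: "ennreal (?q g) + ?n g \<le> ?p g + ennreal (- ?q g)" for g
  proof (cases "?f g \<le> 0")
    case False
    define s where "s = sqrt (?f g)"
    have s: "0 < s" "?f g = s\<^sup>2" using False by (auto simp: s_def)
    have lns: "ln (?f g) = 2 * ln s" using s by (simp add: ln_realpow)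
    have l: "ln s \<le> s - 1" using s ln_le_minus_one by blast
    show ?thesis
    proof (cases "1 \<le> s")
      case True
      thus ?thesis using False l by (simp add: p_eq n_eq lns s_def[symmetric] ennreal_neg ennreal_leI)
    next
      case F: False
      hence "ln s \<le> 0" using s by simp
      thus ?thesis using False F l by (simp add: p_eq n_eq lns s_def[symmetric] ennreal_neg ennreal_leI)
    qed
  qed (simp add: p_eq n_eq)
  have "(\<integral>\<^sup>+g. ennreal (?q g) \<partial>P) + (\<integral>\<^sup>+g. ?n g \<partial>P) \<le> (\<integral>\<^sup>+g. ?p g \<partial>P) + (\<integral>\<^sup>+g. ennreal (- ?q g) \<partial>P)"
    using nn_integral_mono[of P "\<lambda>g. ennreal (?q g) + ?n g" "\<lambda>g. ?p g + ennreal (- ?q g)"] pointwise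
    by (simp add: nn_integral_add)
  moreover have intq: "integrable P ?q" using integrable_sqrt_dens by simp
  moreover have "(\<integral>\<^sup>+g. ?n g \<partial>P) < \<infinity>"
  proof -
    have "?n g \<le> ennreal (?f g)" for g
      using ln_le_minus_one[of "?f g"] by (auto simp: n_eq intro!: ennreal_leI)
    hence "(\<integral>\<^sup>+g. ?n g \<partial>P) \<le> (\<integral>\<^sup>+g. ennreal (?f g) \<partial>P)" by (intro nn_integral_mono)
    also have "\<dots> < \<infinity>" using integrable_dens by (simp add: nn_integral_eq_integral dens_nonneg)
    finally show ?thesis .
  qed
  moreover have "(\<integral>\<^sup>+g. ennreal (?q g) \<partial>P) < \<infinity>" "(\<integral>\<^sup>+g. ennreal (- ?q g) \<partial>P) < \<infinity>"
    using intq unfolding real_integrable_def by (simp_all add: less_top)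
  moreover have "(\<integral>g. ?q g \<partial>P) = enn2real (\<integral>\<^sup>+g. ennreal (?q g) \<partial>P) - enn2real (\<integral>\<^sup>+g. ennreal (- ?q g) \<partial>P)"
    by (rule real_lebesgue_integral_def[OF intq])
  \<comment> \<open>Of the four integrals only that of \<open>?p\<close> can be infinite; the one of
    \<open>?n\<close> is finite because \<open>ln f \<le> f\<close>. The additive inequality may
    therefore be rearranged into a difference.\<close>
  ultimately have "ereal (\<integral>g. ?q g \<partial>P) \<le> enn2ereal (\<integral>\<^sup>+g. ?p g \<partial>P) - enn2ereal (\<integral>\<^sup>+g. ?n g \<partial>P)"
    by (cases "\<integral>\<^sup>+g. ennreal (?q g) \<partial>P"; cases "\<integral>\<^sup>+g. ennreal (- ?q g) \<partial>P"; cases "\<integral>\<^sup>+g. ?p g \<partial>P"; cases "\<integral>\<^sup>+g. ?n g \<partial>P")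
       (auto simp: ennreal_plus[symmetric] enn2ereal_ennreal simp del: ennreal_plus)
  \<comment> \<open>The integrands differ by \<open>?f g - 1\<close>, which has integral 0.\<close>
  moreover have "(\<integral>g. (sqrt (?f g) - 1)\<^sup>2 \<partial>P) = (\<integral>g. ?q g \<partial>P)"
  proof -
    have "(sqrt (?f g) - 1)\<^sup>2 = (?f g - 1) + ?q g" for g
      using dens_nonneg[of P \<eta> g] by (simp add: power2_diff)
    thus ?thesis using integrable_dens integrable_sqrt_dens by (simp add: integral_dens P.prob_space)
  qed
  ultimately show ?thesis using ac by (simp add: hellinger2_eq revKL_def)
qed

end

lemma hellinger2_le_revKL:
  assumes "prob_space P" "prob_space \<eta>" "sets \<eta> = sets P"
  shows "hellinger2 \<eta> P \<le> revKL \<eta> P"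
  using hellinger2_le_revKL_aux[OF assms] by (cases "absolutely_continuous P \<eta>") (auto simp: revKL_def)

lemma hellinger_change_of_measure:
  fixes v :: "'h \<Rightarrow> real"
  assumes "prob_space P" "prob_space \<eta>" "sets \<eta> = sets P" "v \<in> borel_measurable P"
    and "\<And>g. g \<in> space P \<Longrightarrow> - B \<le> v g" "\<And>g. g \<in> space P \<Longrightarrow> v g \<le> c" "c < 1"
  shows "ereal (\<integral>g. v g \<partial>\<eta>) \<le> hellinger2 \<eta> P + ereal (\<integral>g. v g / (1 - v g) \<partial>P)"
proof (cases "absolutely_continuous P \<eta>")
  case True
  show ?thesis
    using hellinger_change_of_measure_aux[OF assms(1-3) True assms(4-)]
    by (simp add: hellinger2_eq[OF assms(1-3) True])
qed (simp add: hellinger2_def)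

lemma TV_change_of_measure:
  fixes x :: "'h \<Rightarrow> real"
  assumes "prob_space P" "prob_space \<eta>" "sets \<eta> = sets P" "x \<in> borel_measurable P"
    and "\<And>g. g \<in> space P \<Longrightarrow> 0 \<le> x g \<and> x g \<le> 1"
  shows "ereal (\<integral>g. x g \<partial>\<eta>) \<le> TV \<eta> P + ereal (\<integral>g. x g \<partial>P)"
proof (cases "absolutely_continuous P \<eta>")
  case True
  show ?thesis
    using TV_change_of_measure_aux[OF assms(1-3) True assms(4-)]
    by (simp add: TV_eq[OF assms(1-3) True])
qed (simp add: TV_def)

section \<open>The surrogate gap\<close>

text \<open>The comparison for one sample, where \<open>gap_bound\<close> is 1/2, and a gap
  \<open>x\<close> of at most 1/2. In terms of the deficit \<open>t = 1 / 2 - x\<close> the right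
  side is \<open>- (t - t\<^sup>2)\<close>, while \<open>v \<le> - t / 2\<close>.\<close>

lemma frac_le_quadratic_surrogate:
  fixes x d :: real
  assumes "0 \<le> x" "x \<le> 1 / 2" "0 \<le> d" "d \<le> 1 / 2"
  defines "v \<equiv> (x + d) / 2 - 1 / 2"
  shows "2 * (v / (1 - v)) \<le> x\<^sup>2 + 1 / 4 - 1 / 2"
proof -
  define t where "t = 1 / 2 - x"
  have t: "0 \<le> t" "t \<le> 1 / 2" using assms by (auto simp: t_def)
  have v: "v \<le> - t / 2" "-1 / 2 \<le> v" using assms(1-4) by (auto simp: t_def v_def field_simps)
  have tt: "0 \<le> t - t\<^sup>2" "t - t\<^sup>2 \<le> 1" using t mult_left_le[of t t] zero_le_square[of t] unfolding power2_eq_square by linarith+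
  have "v * (2 - (t - t\<^sup>2)) \<le> - t / 2 * (2 - (t - t\<^sup>2))"
    using v tt by (intro mult_right_mono) auto
  also have "\<dots> \<le> - (t - t\<^sup>2)" using t by (simp add: power2_eq_square algebra_simps)
  finally have "2 * v \<le> - (t - t\<^sup>2) * (1 - v)" by (simp add: algebra_simps)
  hence "2 * v / (1 - v) \<le> - (t - t\<^sup>2)" using v t by (simp add: pos_divide_le_eq)
  moreover have "- (t - t\<^sup>2) = x\<^sup>2 + 1 / 4 - 1 / 2" by (simp add: t_def power2_eq_square field_simps)
  ultimately show ?thesis by simp
qed

text \<open>The comparison for one sample and a gap \<open>1 / 2 + s\<close>. Here
  \<open>d \<le> 1 / 2\<close> would be too weak: the improved bound on \<open>d\<close> gives
  \<open>v \<le> (s - s\<^sup>2) / 2\<close>, and this quadratic gain pays for the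
  denominator.\<close>

lemma frac_le_excess:
  fixes s d :: real
  assumes "0 \<le> s" "s \<le> 1 / 2" "0 \<le> d" "d \<le> 1 / 2 - s\<^sup>2"
  defines "v \<equiv> (1 / 2 + s + d) / 2 - 1 / 2"
  shows "2 * (v / (1 - v)) \<le> s"
proof -
  have v: "v \<le> (s - s\<^sup>2) / 2" using assms(1-4) by (simp add: v_def field_simps)
  have "v * (2 + s) \<le> (s - s\<^sup>2) / 2 * (2 + s)" using v assms by (intro mult_right_mono) auto
  also have "\<dots> \<le> s" using assms by (simp add: power2_eq_square algebra_simps)
  finally have "2 * v \<le> s * (1 - v)" by (simp add: algebra_simps)
  moreover have "0 < 1 - v"
  proof -
    have "2 * v \<le> s - s\<^sup>2" "0 \<le> s\<^sup>2" using v by simp_all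
    thus ?thesis using assms(2) by linarith
  qed
  ultimately have "2 * v / (1 - v) \<le> s" by (simp add: pos_divide_le_eq)
  thus ?thesis by simp
qed

text \<open>The comparison for several samples. If \<open>b \<le> x\<close>, then
  \<open>2 * v \<le> x - b \<le> 1 - b\<close>, so \<open>2 - 2 * v\<close> is at least
  \<open>1 + b\<close>. Otherwise \<open>v\<close> lies between \<open>- b\<close> and 0, and
  enlarging the denominator to \<open>1 + b\<close> increases the nonpositive fraction.\<close>

lemma frac_le_max_surrogate:
  fixes x d b :: real
  assumes "0 \<le> x" "x \<le> 1" "0 \<le> d" "d \<le> b" "0 < b"
  defines "v \<equiv> (x + d) / 2 - b"
  shows "2 * (v / (1 - v)) \<le> 2 / (1 + b) * (max x ((x + d) / 2) - b)"
proof (cases "b \<le> x")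
  case True
  have r: "2 * v \<le> x - b" using assms(1-5) by (simp add: v_def field_simps)
  have "2 * v * (1 + b) \<le> (x - b) * (1 + b)" using r assms by (intro mult_right_mono) auto
  also have "\<dots> \<le> (x - b) * (2 - 2 * v)" using r assms(1-5) True by (intro mult_left_mono) linarith+
  finally have "v * (1 + b) \<le> (x - b) * (1 - v)" by (simp add: algebra_simps)
  hence "v / (1 - v) \<le> (x - b) / (1 + b)"
    using r assms(1-5) True by (simp add: divide_simps mult.commute)
  also have "\<dots> \<le> (max x ((x + d) / 2) - b) / (1 + b)" using assms by (intro divide_right_mono) auto
  finally have "2 * (v / (1 - v)) \<le> 2 * ((max x ((x + d) / 2) - b) / (1 + b))" by (intro mult_left_mono) auto
  thus ?thesis by (simp only: times_divide_eq_left times_divide_eq_right)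
next
  case False
  have v: "v \<le> 0" "- b \<le> v" using False assms(1-5) by (auto simp: v_def field_simps)
  have "v * (1 + b) \<le> v * (1 - v)" using v by (intro mult_left_mono_neg) auto
  hence "v / (1 - v) \<le> v / (1 + b)" using v assms(1-5) by (simp add: divide_simps mult.commute)
  also have "\<dots> \<le> (max x ((x + d) / 2) - b) / (1 + b)" using assms by (intro divide_right_mono) (auto simp: v_def)
  finally have "2 * (v / (1 - v)) \<le> 2 * ((max x ((x + d) / 2) - b) / (1 + b))" by (intro mult_left_mono) auto
  thus ?thesis by (simp only: times_divide_eq_left times_divide_eq_right)
qed

section \<open>Moments of the gap over the sample\<close>

locale bounded_loss =
  fixes H :: "'h measure" and D :: "'z measure" and l :: "'h \<Rightarrow> 'z \<Rightarrow> real" and m :: nat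
  assumes D: "prob_space D"
    and l_meas [measurable]: "(\<lambda>(h, z). l h z) \<in> borel_measurable (H \<Otimes>\<^sub>M D)"
    and l_bdd: "\<And>h z. h \<in> space H \<Longrightarrow> z \<in> space D \<Longrightarrow> 0 \<le> l h z \<and> l h z \<le> 1"
    and m: "m > 0"
begin

sublocale D: prob_space D by (rule D)
abbreviation "samples \<equiv> PiM {..<m} (\<lambda>_. D)"

sublocale PD: prob_space samples by (intro prob_space_PiM D)

abbreviation "gap \<equiv> gen_gap D m l"
abbreviation "risk \<equiv> true_risk D l"

definition "mean_gap h = (\<integral>S. gap S h \<partial>samples)"
definition "gap_bound = 1 / (2 * sqrt (real m))"

lemma gap_bound_pos: "0 < gap_bound" using m by (simp add: gap_bound_def)

lemma gap_bound_sq: "gap_bound\<^sup>2 = 1 / (4 * real m)"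
  by (simp add: gap_bound_def power_divide power_mult_distrib)

lemma loss_measurable: "h \<in> space H \<Longrightarrow> l h \<in> borel_measurable D"
  using measurable_compose[OF measurable_Pair1' l_meas, of h] by simp

lemma gap_eq: "gap S h = \<bar>\<Sum>i<m. l h (S i) - risk h\<bar> / real m"
proof -
  have "risk h - emp_risk m l S h = - ((\<Sum>i<m. l h (S i) - risk h) / real m)"
    using m by (simp add: emp_risk_def sum_subtractf field_simps)
  thus ?thesis by (simp add: gen_gap_def)
qed

lemma risk_bounds:
  assumes "h \<in> space H"
  shows "0 \<le> risk h" "risk h \<le> 1"
  using unit_mean[OF D loss_measurable[OF assms] l_bdd[OF assms] refl] by (simp_all add: true_risk_def)

text \<open>The empirical risk lies in the unit interval. This form is sharper than the bound 1: a
  gap above 1/2 forces the risk away from 1/2, which is used for \<open>m = 1\<close>.\<close>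

lemma gap_le:
  assumes h: "h \<in> space H" and S: "S \<in> space samples"
  shows "gap S h \<le> max (risk h) (1 - risk h)"
proof -
  have Si: "0 \<le> l h (S i) \<and> l h (S i) \<le> 1" if "i < m" for i
    using l_bdd[OF h, of "S i"] S that by (auto simp: space_PiM)
  have "0 \<le> emp_risk m l S h" unfolding emp_risk_def using Si by (intro mult_nonneg_nonneg sum_nonneg) auto
  moreover have "emp_risk m l S h \<le> 1"
  proof -
    have "(\<Sum>i<m. l h (S i)) \<le> (\<Sum>i<m. 1)" using Si by (intro sum_mono) auto
    thus ?thesis using m by (simp add: emp_risk_def)
  qed
  ultimately show ?thesis unfolding gen_gap_def by linarith
qed

lemma gap_bounds:
  assumes h: "h \<in> space H" and S: "S \<in> space samples"
  shows "0 \<le> gap S h" "gap S h \<le> 1"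
  using gap_le[OF assms] risk_bounds[OF h] by (auto simp: gen_gap_def)

lemma gap_diff_le:
  assumes h: "h \<in> space H" and S: "S \<in> space samples" and i: "i < m" and z: "z \<in> space D"
  shows "\<bar>gap (S(i := z)) h - gap S h\<bar> \<le> 1 / real m"
proof -
  have "(\<Sum>j<m. l h ((S(i := z)) j)) - (\<Sum>j<m. l h (S j)) = (\<Sum>j<m. if j = i then l h z - l h (S i) else 0)"
    unfolding sum_subtractf[symmetric] by (intro sum.cong) auto
  also have "\<dots> = l h z - l h (S i)" using i by simp
  finally have "emp_risk m l (S(i := z)) h - emp_risk m l S h = (l h z - l h (S i)) / real m"
    unfolding emp_risk_def right_diff_distrib[symmetric] by (simp only:) simp
  moreover have "\<bar>l h z - l h (S i)\<bar> \<le> 1"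
  proof -
    have "S i \<in> space D" using S i by (auto simp: space_PiM)
    thus ?thesis using l_bdd[OF h z] l_bdd[OF h, of "S i"] by linarith
  qed
  hence "\<bar>(l h z - l h (S i)) / real m\<bar> \<le> 1 / real m" using m by (simp add: divide_right_mono)
  ultimately show ?thesis unfolding gen_gap_def by linarith
qed

lemma risk_measurable [measurable]: "risk \<in> borel_measurable H"
  unfolding true_risk_def[abs_def] by measurable

lemma gap_measurable_pair [measurable]: "(\<lambda>(h, S). gap S h) \<in> borel_measurable (H \<Otimes>\<^sub>M samples)"
proof -
  have "(\<lambda>(h, S). l h (S i)) \<in> borel_measurable (H \<Otimes>\<^sub>M samples)" if "i < m" for i
  proof -
    have "(\<lambda>(h, S). (h, S i)) \<in> measurable (H \<Otimes>\<^sub>M samples) (H \<Otimes>\<^sub>M D)"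
    proof -
      have [measurable]: "(\<lambda>S. S i) \<in> measurable samples D"
        using that by (intro measurable_component_singleton) auto
      show ?thesis by measurable
    qed
    from measurable_compose[OF this l_meas] show ?thesis by (simp add: case_prod_beta')
  qed
  hence [measurable]: "(\<lambda>x. l (fst x) (snd x i)) \<in> borel_measurable (H \<Otimes>\<^sub>M samples)" if "i \<in> {..<m}" for i
    using that by (simp add: case_prod_beta')
  show ?thesis unfolding gen_gap_def emp_risk_def case_prod_beta' by measurable
qed

lemma gap_measurable_sample [measurable]: "h \<in> space H \<Longrightarrow> (\<lambda>S. gap S h) \<in> borel_measurable samples"
  using measurable_compose[OF measurable_Pair1' gap_measurable_pair, of h] by simp

lemma gap_measurable_hyp [measurable]: "S \<in> space samples \<Longrightarrow> gap S \<in> borel_measurable H"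
  using measurable_compose[OF measurable_Pair2' gap_measurable_pair, of S] by simp

lemma mean_gap_measurable [measurable]: "mean_gap \<in> borel_measurable H"
  unfolding mean_gap_def[abs_def] by measurable

lemma integrable_gap: "h \<in> space H \<Longrightarrow> integrable samples (\<lambda>S. gap S h)"
  by (rule PD.integrable_const_bound[of _ 1]) (auto intro!: AE_I2 simp: gap_bounds)

lemma integrable_gap_sq: "h \<in> space H \<Longrightarrow> integrable samples (\<lambda>S. (gap S h)\<^sup>2)"
  by (rule PD.integrable_const_bound[of _ 1]) (auto intro!: AE_I2 simp: gap_bounds power_le_one)

lemma mean_gap_nonneg: "h \<in> space H \<Longrightarrow> 0 \<le> mean_gap h"
  unfolding mean_gap_def by (intro integral_nonneg_AE AE_I2) (rule gap_bounds)

text \<open>A variable in the unit interval with mean \<open>r\<close> has variance at most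
  \<open>r * (1 - r)\<close>, and independence divides this by \<open>m\<close>.\<close>

lemma mean_gap_sq_le:
  assumes "h \<in> space H"
  shows "(\<integral>S. (gap S h)\<^sup>2 \<partial>samples) \<le> risk h * (1 - risk h) / real m"
proof -
  have "(\<integral>S. (gap S h)\<^sup>2 \<partial>samples) = (\<integral>S. (0 + (\<Sum>i<m. l h (S i) - risk h))\<^sup>2 \<partial>samples) / (real m)\<^sup>2"
    by (simp add: gap_eq power_divide)
  also have "\<dots> \<le> (0\<^sup>2 + real m * (risk h * (1 - risk h))) / (real m)\<^sup>2"
    using centered_sum_square_le[OF D loss_measurable[OF assms] l_bdd[OF assms] refl, where b = 0 and n = m]
    by (intro divide_right_mono) (simp_all add: true_risk_def)
  also have "\<dots> = risk h * (1 - risk h) / real m" using m by (simp add: power2_eq_square)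
  finally show ?thesis .
qed

lemma mean_gap_sq_le_gap_bound:
  assumes "h \<in> space H"
  shows "(\<integral>S. (gap S h)\<^sup>2 \<partial>samples) \<le> gap_bound\<^sup>2"
proof -
  have "risk h * (1 - risk h) \<le> 1 / 4"
    using zero_le_power2[of "risk h - 1/2"]
    by (simp add: power2_eq_square algebra_simps)
  hence "risk h * (1 - risk h) / real m \<le> (1 / 4) / real m" by (intro divide_right_mono) auto
  thus ?thesis using mean_gap_sq_le[OF assms] by (simp add: gap_bound_sq)
qed

text \<open>Integrates \<open>x \<le> (x\<^sup>2 / c + c) / 2\<close>, which is
  \<open>(x - c)\<^sup>2 \<ge> 0\<close> divided by \<open>2 * c\<close>. The choice
  \<open>c = gap_bound\<close> gives \<open>mean_gap_le\<close>; \<open>c = 1 / 2\<close> is used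
  for one sample.\<close>

lemma mean_gap_le_sq:
  assumes "h \<in> space H" "0 < c"
  shows "mean_gap h \<le> ((\<integral>S. (gap S h)\<^sup>2 \<partial>samples) / c + c) / 2"
proof -
  have "mean_gap h \<le> (\<integral>S. ((gap S h)\<^sup>2 / c + c) / 2 \<partial>samples)"
    unfolding mean_gap_def
  proof (rule integral_mono)
    fix S
    have "0 \<le> (gap S h - c)\<^sup>2 / c" using assms by simp
    thus "gap S h \<le> ((gap S h)\<^sup>2 / c + c) / 2" using assms by (simp add: power2_diff field_simps power2_eq_square)
  qed (use assms integrable_gap integrable_gap_sq in auto)
  also have "\<dots> = ((\<integral>S. (gap S h)\<^sup>2 \<partial>samples) / c + c) / 2"
    using integrable_gap_sq[OF assms(1)] by (simp add: PD.prob_space)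
  finally show ?thesis .
qed

lemma mean_gap_le:
  assumes "h \<in> space H"
  shows "mean_gap h \<le> gap_bound"
proof -
  have "(\<integral>S. (gap S h)\<^sup>2 \<partial>samples) / gap_bound \<le> gap_bound\<^sup>2 / gap_bound"
    using mean_gap_sq_le_gap_bound[OF assms] gap_bound_pos by (intro divide_right_mono) auto
  thus ?thesis using mean_gap_le_sq[OF assms gap_bound_pos] gap_bound_pos by (simp add: power2_eq_square)
qed

text \<open>Comparison with Bernoulli losses and de Moivre's formula improve the variance bound by
  the factor 15/17. This ratio is exactly the condition
  \<open>gap_bound + d \<le> 16 * (gap_bound - d)\<close> on the mean gap \<open>d\<close> that
  \<open>surrogate_mean_le\<close> needs.\<close>

lemma mean_gap_le_binomial:
  assumes h: "h \<in> space H" and "2 \<le> m"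
  shows "mean_gap h \<le> 15 / 17 * gap_bound"
proof -
  have "(\<integral>S. \<bar>0 + (\<Sum>i<m. l h (S i) - risk h)\<bar> \<partial>samples)
      \<le> (\<Sum>k\<le>m. real (m choose k) * ((risk h) ^ k * (1 - risk h) ^ (m - k) * \<bar>0 + real k - real m * risk h\<bar>))"
    using centered_sum_abs_le_binomial[OF D loss_measurable[OF h] l_bdd[OF h] refl, where b = 0 and n = m]
    by (simp add: true_risk_def)
  also have "\<dots> \<le> 15 / 34 * sqrt (real m)"
    using binomial_mean_abs_deviation_le[OF risk_bounds[OF h] assms(2)] by (simp add: mult.assoc)
  finally have "mean_gap h \<le> 15 / 34 * sqrt (real m) / real m"
    unfolding mean_gap_def gap_eq integral_divide_zero by (intro divide_right_mono) simp_all
  also have "\<dots> = 15 / 17 * gap_bound"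
    using m real_sqrt_mult_self[of "real m"] by (simp add: gap_bound_def field_simps)
  finally show ?thesis .
qed

text \<open>The functions \<open>\<phi>\<close> and the constant \<open>\<lambda>\<close> of the introduction.\<close>

definition surrogate :: "'h \<Rightarrow> real \<Rightarrow> real" where
  "surrogate h x = (if m = 1 then if x \<le> 1 / 2 then x\<^sup>2 + 1 / 4 else x else max x ((x + mean_gap h) / 2))"

definition "weight = (if m = 1 then 1 else 2 / (1 + gap_bound))"

lemma surrogate_1: "m = 1 \<Longrightarrow> surrogate h x = (if x \<le> 1 / 2 then x\<^sup>2 + 1 / 4 else x)"
  unfolding surrogate_def by simp

lemma gap_bound_1: "m = 1 \<Longrightarrow> gap_bound = 1 / 2"
  unfolding gap_bound_def by simp

lemma weight_1: "m = 1 \<Longrightarrow> weight = 1"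
  unfolding weight_def by simp

lemma surrogate_ge: "x \<le> surrogate h x"
  using zero_le_power2[of "x - 1 / 2"]
  by (auto simp: surrogate_def power2_eq_square algebra_simps)

text \<open>For \<open>m = 1\<close> the parabola has slope at most 1 on the interval from 0 to 1/2
  and meets the identity at 1/2; otherwise the function is a maximum of lines of slopes 1 and
  1/2.\<close>

lemma surrogate_lipschitz_aux:
  fixes x y :: real
  assumes "0 \<le> x" "x \<le> y"
  shows "surrogate h x \<le> surrogate h y \<and> surrogate h y - surrogate h x \<le> y - x"
proof (cases "m = 1")
  case True
  have sq: "b\<^sup>2 - a\<^sup>2 = (b - a) * (b + a)" for a b :: real by (simp add: power2_eq_square algebra_simps)
  consider "y \<le> 1 / 2" | "x \<le> 1 / 2" "1 / 2 < y" | "1 / 2 < x" by linarith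
  thus ?thesis
  proof cases
    case 1
    have "(y - x) * (y + x) \<le> (y - x) * 1" "0 \<le> (y - x) * (y + x)"
      using 1 assms by (intro mult_left_mono mult_nonneg_nonneg; linarith)+
    thus ?thesis using 1 assms sq[of y x] unfolding surrogate_1[OF True] by simp
  next
    case 2
    have "(1 / 2 - x) * (1 / 2 + x) \<le> (1 / 2 - x) * 1" "0 \<le> (1 / 2 - x) * (1 / 2 + x)"
      using 2 assms by (intro mult_left_mono mult_nonneg_nonneg; linarith)+
    hence "1 / 4 - x\<^sup>2 \<le> 1 / 2 - x" "0 \<le> 1 / 4 - x\<^sup>2" using sq[of "1 / 2" x] by (simp_all add: power_divide)
    thus ?thesis using 2 unfolding surrogate_1[OF True] by auto
  qed (use assms in \<open>auto simp: surrogate_1[OF True]\<close>)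
next
  case False
  thus ?thesis using assms by (auto simp: surrogate_def max_def field_simps)
qed

lemma surrogate_lipschitz:
  assumes "0 \<le> x" "0 \<le> y"
  shows "\<bar>surrogate h y - surrogate h x\<bar> \<le> \<bar>y - x\<bar>"
  using surrogate_lipschitz_aux[of x y h] surrogate_lipschitz_aux[of y x h] assms
  by (cases "x \<le> y") auto

lemma surrogate_bounds:
  assumes h: "h \<in> space H" and S: "S \<in> space samples"
  shows "0 \<le> surrogate h (gap S h)" "surrogate h (gap S h) \<le> 2"
proof -
  show "0 \<le> surrogate h (gap S h)" using surrogate_ge gap_bounds(1)[OF assms] order_trans by blast
  have "1 \<le> sqrt (real m)" using m by simp
  hence "1 \<le> 2 * sqrt (real m)" by linarith
  hence "gap_bound \<le> 1" unfolding gap_bound_def by (subst divide_le_eq) auto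
  hence "surrogate h 0 \<le> 1" using mean_gap_le[OF h] mean_gap_nonneg[OF h] by (auto simp: surrogate_def)
  thus "surrogate h (gap S h) \<le> 2" using surrogate_lipschitz_aux[of 0 "gap S h" h] gap_bounds[OF assms] by simp
qed

lemma surrogate_measurable_pair [measurable]:
  "(\<lambda>(h, S). surrogate h (gap S h)) \<in> borel_measurable (H \<Otimes>\<^sub>M samples)"
proof -
  have [measurable]: "(\<lambda>x. gap (snd x) (fst x)) \<in> borel_measurable (H \<Otimes>\<^sub>M samples)"
    using gap_measurable_pair by (simp add: case_prod_beta')
  show ?thesis unfolding surrogate_def case_prod_beta' by measurable
qed

lemma surrogate_measurable_hyp: "S \<in> space samples \<Longrightarrow> (\<lambda>h. surrogate h (gap S h)) \<in> borel_measurable H"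
  using measurable_compose[OF measurable_Pair2' surrogate_measurable_pair, of S] by simp

text \<open>For \<open>m = 1\<close> the surrogate is at most \<open>x\<^sup>2 + 1 / 4\<close>
  everywhere, and the second moment of the gap is at most 1/4. Otherwise it equals
  \<open>(3 * x + d) / 4 + \<bar>x - d\<bar> / 4\<close>, so its mean exceeds \<open>d\<close> by a
  quarter of the mean absolute deviation of the gap, which the variance controls.\<close>

lemma surrogate_mean_le:
  assumes h: "h \<in> space H"
  shows "(\<integral>S. surrogate h (gap S h) \<partial>samples) \<le> gap_bound"
proof (cases "m = 1")
  case True
  have "(\<integral>S. surrogate h (gap S h) \<partial>samples) \<le> (\<integral>S. (gap S h)\<^sup>2 + 1 / 4 \<partial>samples)"
  proof (rule integral_mono_AE')
    show "integrable samples (\<lambda>S. (gap S h)\<^sup>2 + 1 / 4)" using integrable_gap_sq[OF h] by simp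
    show "AE S in samples. surrogate h (gap S h) \<le> (gap S h)\<^sup>2 + 1 / 4"
    proof (rule AE_I2)
      fix S
      show "surrogate h (gap S h) \<le> (gap S h)\<^sup>2 + 1 / 4"
        using zero_le_power2[of "gap S h - 1 / 2"]
        unfolding surrogate_1[OF True] by (auto simp: power2_eq_square algebra_simps)
    qed
  qed auto
  also have "\<dots> = (\<integral>S. (gap S h)\<^sup>2 \<partial>samples) + 1 / 4"
    using integrable_gap_sq[OF h] by (simp add: PD.prob_space)
  also have "\<dots> \<le> gap_bound"
    using mean_gap_sq_le_gap_bound[OF h] unfolding gap_bound_1[OF True] by (simp add: power2_eq_square)
  finally show ?thesis .
next
  case False
  hence m2: "2 \<le> m" using m by simp
  let ?d = "mean_gap h"
  \<comment> \<open>An upper bound for the standard deviation of the gap, chosen so that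
    \<open>?d + c / 4\<close> is exactly \<open>gap_bound\<close>.\<close>
  define c where "c = 4 * (gap_bound - ?d)"
  have d: "17 * ?d \<le> 15 * gap_bound" using mean_gap_le_binomial[OF h m2] by simp
  have c: "0 < c" using d gap_bound_pos by (simp add: c_def)
  have int: "integrable samples (\<lambda>S. (gap S h - ?d)\<^sup>2)"
    using integrable_gap[OF h] integrable_gap_sq[OF h] by (simp add: power2_diff)
  have var: "(\<integral>S. (gap S h - ?d)\<^sup>2 \<partial>samples) = (\<integral>S. (gap S h)\<^sup>2 \<partial>samples) - ?d\<^sup>2"
    using integrable_gap[OF h] integrable_gap_sq[OF h]
    by (simp add: power2_diff PD.prob_space mean_gap_def[symmetric]) (simp add: power2_eq_square)
  have "(\<integral>S. surrogate h (gap S h) \<partial>samples)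
      \<le> (\<integral>S. (3 * gap S h + ?d) / 4 + ((gap S h - ?d)\<^sup>2 / c + c) / 8 \<partial>samples)"
  proof (rule integral_mono_AE')
    show "integrable samples (\<lambda>S. (3 * gap S h + ?d) / 4 + ((gap S h - ?d)\<^sup>2 / c + c) / 8)"
      using integrable_gap[OF h] int by simp
    have le: "surrogate h (gap S h) \<le> (3 * gap S h + ?d) / 4 + ((gap S h - ?d)\<^sup>2 / c + c) / 8" for S
    proof -
      have "0 \<le> (\<bar>gap S h - ?d\<bar> - c)\<^sup>2 / c" using c by simp
      hence "\<bar>gap S h - ?d\<bar> \<le> ((gap S h - ?d)\<^sup>2 / c + c) / 2"
        using c by (simp add: power2_diff field_simps power2_eq_square)
      moreover have "surrogate h (gap S h) = (3 * gap S h + ?d) / 4 + \<bar>gap S h - ?d\<bar> / 4"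
        using False by (auto simp: surrogate_def max_def field_simps)
      ultimately show ?thesis by simp
    qed
    show "AE S in samples. surrogate h (gap S h) \<le> (3 * gap S h + ?d) / 4 + ((gap S h - ?d)\<^sup>2 / c + c) / 8"
      by (rule AE_I2) (rule le)
    show "AE S in samples. 0 \<le> (3 * gap S h + ?d) / 4 + ((gap S h - ?d)\<^sup>2 / c + c) / 8"
      by (rule AE_I2) (use le surrogate_bounds(1)[OF h] order_trans in blast)
  qed
  also have "\<dots> = ?d + ((\<integral>S. (gap S h - ?d)\<^sup>2 \<partial>samples) / c + c) / 8"
    using integrable_gap[OF h] int
    by (simp add: PD.prob_space mean_gap_def[symmetric] field_simps)
  also have "\<dots> \<le> ?d + (c\<^sup>2 / c + c) / 8"
  proof -
    have "(\<integral>S. (gap S h - ?d)\<^sup>2 \<partial>samples) \<le> gap_bound\<^sup>2 - ?d\<^sup>2"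
      using var mean_gap_sq_le_gap_bound[OF h] by simp
    also have "\<dots> = (gap_bound - ?d) * (gap_bound + ?d)" by (simp add: power2_eq_square algebra_simps)
    \<comment> \<open>The de Moivre bound \<open>17 * ?d \<le> 15 * gap_bound\<close> enters
      here.\<close>
    also have "\<dots> \<le> (gap_bound - ?d) * (16 * (gap_bound - ?d))"
      using d c by (intro mult_left_mono) (auto simp: c_def)
    also have "\<dots> = c\<^sup>2" by (simp add: c_def power2_eq_square algebra_simps)
    finally show ?thesis using c by (intro add_left_mono divide_right_mono add_right_mono) auto
  qed
  also have "\<dots> = ?d + c / 4" using c by (simp add: power2_eq_square)
  also have "\<dots> = gap_bound" by (simp add: c_def field_simps)
  finally show ?thesis .
qed

lemma surrogate_dominates:
  assumes h: "h \<in> space H" and S: "S \<in> space samples"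
  defines "v \<equiv> (gap S h + mean_gap h) / 2 - gap_bound"
  shows "2 * (v / (1 - v)) \<le> weight * (surrogate h (gap S h) - gap_bound)"
proof (cases "m = 1")
  case False
  thus ?thesis
    using frac_le_max_surrogate[OF gap_bounds[OF h S] mean_gap_nonneg[OF h] mean_gap_le[OF h] gap_bound_pos]
    by (simp add: weight_def surrogate_def v_def)
next
  case True
  note one = gap_bound_1[OF True] weight_1[OF True] surrogate_1[OF True]
  show ?thesis
  proof (cases "gap S h \<le> 1 / 2")
    case le: True
    show ?thesis
      using frac_le_quadratic_surrogate[OF gap_bounds(1)[OF h S] le mean_gap_nonneg[OF h]] mean_gap_le[OF h] le
      unfolding v_def one by simp
  next
    case gt: False
    define s where "s = gap S h - 1 / 2"
    have s: "0 \<le> s" "s \<le> 1 / 2" using gt gap_bounds[OF h S] by (auto simp: s_def)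
    \<comment> \<open>The excess \<open>s\<close> bounds the distance of the risk from 1/2 from
      below; this lowers the variance to at most \<open>1 / 4 - s\<^sup>2\<close> and the mean gap
      to at most \<open>1 / 2 - s\<^sup>2\<close>.\<close>
    have "s \<le> \<bar>risk h - 1 / 2\<bar>" using gap_le[OF h S] by (auto simp: s_def abs_if split: if_splits)
    hence "s\<^sup>2 \<le> (risk h - 1 / 2)\<^sup>2" using s power_mono[of s "\<bar>risk h - 1/2\<bar>" 2] by simp
    hence "risk h * (1 - risk h) \<le> 1 / 4 - s\<^sup>2" by (simp add: power2_eq_square algebra_simps)
    hence "mean_gap h \<le> 1 / 2 - s\<^sup>2"
      using mean_gap_le_sq[OF h, of "1 / 2"] mean_gap_sq_le[OF h] True by simp
    from frac_le_excess[OF s mean_gap_nonneg[OF h] this] show ?thesis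
      using gt unfolding v_def one by (simp add: s_def)
  qed
qed

lemma weight_nonneg: "0 \<le> weight" using gap_bound_pos by (simp add: weight_def)

text \<open>A common upper bound that lies below both deviation constants of the theorem, once these
  are multiplied by \<open>2 * m\<close>. For several samples it amounts to
  \<open>1 \<le> 2 * m * gap_bound = sqrt m\<close>.\<close>

lemma weight_le: "weight \<le> 4 * real m / (2 * real m + 1)"
proof (cases "m = 1")
  case True
  thus ?thesis unfolding weight_def by simp
next
  case False
  have "1 \<le> 2 * real m * gap_bound"
    using m real_sqrt_mult_self[of "real m"] by (simp add: gap_bound_def real_div_sqrt)
  hence "2 / (1 + gap_bound) \<le> 4 * real m / (2 * real m + 1)"
    using gap_bound_pos m by (simp add: divide_simps algebra_simps)
  thus ?thesis using False by (simp add: weight_def)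
qed

lemma weight_le_hellinger: "weight \<le> 4 * real m / (real m + 1)"
proof -
  have "4 * real m / (2 * real m + 1) \<le> 4 * real m / (real m + 1)"
    using m by (intro divide_left_mono) auto
  thus ?thesis using weight_le by linarith
qed

lemma weight_le_revKL: "weight \<le> 2 * real m * ln (1 + 1 / real m)"
proof -
  have "2 / (2 * real m + 1) \<le> ln (1 + 1 / real m)"
    using ln_inverse_approx_ge[of "real m" "real m + 1"] ln_div[of "real m + 1" "real m"] m
    by (simp add: add_divide_distrib add.commute)
  hence "2 * real m * (2 / (2 * real m + 1)) \<le> 2 * real m * ln (1 + 1 / real m)"
    by (intro mult_left_mono) auto
  thus ?thesis using weight_le by simp
qed

section \<open>The three bounds\<close>

lemma integrable_gap_hyp:
  assumes "prob_space Q" "sets Q = sets H" "S \<in> space samples"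
  shows "integrable Q (gap S)"
proof -
  interpret Q: prob_space Q by fact
  show ?thesis
    by (rule Q.integrable_const_bound[of _ 1])
       (use gap_measurable_hyp[OF assms(3)] sets_eq_imp_space_eq[OF assms(2)] assms(3) in
        \<open>auto intro!: AE_I2 simp: gap_bounds measurable_cong_sets[OF assms(2) refl]\<close>)
qed

lemma integrable_surrogate_hyp:
  assumes "prob_space Q" "sets Q = sets H" "S \<in> space samples"
  shows "integrable Q (\<lambda>h. surrogate h (gap S h))"
proof -
  interpret Q: prob_space Q by fact
  show ?thesis
    by (rule Q.integrable_const_bound[of _ 2])
       (use surrogate_measurable_hyp[OF assms(3)] sets_eq_imp_space_eq[OF assms(2)] assms(3) in
        \<open>auto intro!: AE_I2 simp: surrogate_bounds measurable_cong_sets[OF assms(2) refl]\<close>)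
qed

lemma integral_gap_fubini:
  assumes "prob_space \<eta>" "sets \<eta> = sets H"
  shows "integrable samples (\<lambda>S. \<integral>h. gap S h \<partial>\<eta>)"
    and "(\<integral>S. (\<integral>h. gap S h \<partial>\<eta>) \<partial>samples) = (\<integral>h. mean_gap h \<partial>\<eta>)"
proof -
  interpret \<eta>: prob_space \<eta> by fact
  interpret pair: pair_prob_space \<eta> samples ..
  have sp: "space \<eta> = space H" by (rule sets_eq_imp_space_eq) fact
  have meas: "(\<lambda>(h, S). gap S h) \<in> borel_measurable (\<eta> \<Otimes>\<^sub>M samples)"
    using gap_measurable_pair by (simp add: measurable_cong_sets[OF sets_pair_measure_cong[OF assms(2) refl] refl])
  have int: "integrable (\<eta> \<Otimes>\<^sub>M samples) (\<lambda>(h, S). gap S h)"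
    by (rule pair.integrable_const_bound[of _ 1])
       (auto intro!: AE_I2 meas simp: space_pair_measure sp gap_bounds)
  show "integrable samples (\<lambda>S. \<integral>h. gap S h \<partial>\<eta>)" by (rule pair.integrable_snd[OF int])
  show "(\<integral>S. (\<integral>h. gap S h \<partial>\<eta>) \<partial>samples) = (\<integral>h. mean_gap h \<partial>\<eta>)"
    unfolding mean_gap_def by (rule pair.Fubini_integral[OF int])
qed

text \<open>The mean of the surrogate under \<open>P\<close> changes by at most \<open>1 / m\<close>
  when one sample point changes, and by Fubini its expectation is at most \<open>gap_bound\<close>,
  so McDiarmid's inequality applies. The event depends on the prior only, hence serves all \<rho>
  and \<eta> at once.\<close>

lemma surrogate_event:
  fixes P :: "'h measure" and \<delta> :: real
  assumes P: "prob_space P" and sets_P: "sets P = sets H" and \<delta>: "0 < \<delta>" "\<delta> < 1"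
  shows "\<exists>A\<in>sets samples. 1 - \<delta> \<le> measure samples A \<and>
    (\<forall>S\<in>A. (\<integral>h. surrogate h (gap S h) \<partial>P) \<le> gap_bound + sqrt (ln (1 / \<delta>) / (2 * real m)))"
proof -
  interpret P: prob_space P by fact
  interpret pair: pair_prob_space P samples ..
  define \<sigma> where "\<sigma> = sqrt (ln (1 / \<delta>) / (2 * real m))"
  have L: "0 < ln (1 / \<delta>)" using \<delta> by simp
  have \<sigma>: "0 < \<sigma>" using L m by (simp add: \<sigma>_def)
  have sp: "space P = space H" by (rule sets_eq_imp_space_eq) fact
  have meas: "(\<lambda>(h, S). surrogate h (gap S h)) \<in> borel_measurable (P \<Otimes>\<^sub>M samples)"
    using surrogate_measurable_pair by (simp add: measurable_cong_sets[OF sets_pair_measure_cong[OF sets_P refl] refl])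
  have int: "integrable (P \<Otimes>\<^sub>M samples) (\<lambda>(h, S). surrogate h (gap S h))"
    by (rule pair.integrable_const_bound[of _ 2])
       (auto intro!: AE_I2 meas simp: space_pair_measure sp surrogate_bounds)
  define F where "F S = (\<integral>h. surrogate h (gap S h) \<partial>P)" for S
  have [measurable]: "F \<in> borel_measurable samples"
    using pair.integrable_snd[OF int] by (auto simp: F_def[abs_def])
  note intS = integrable_surrogate_hyp[OF P sets_P]
  have EF: "(\<integral>S. F S \<partial>samples) \<le> gap_bound"
  proof -
    have "(\<integral>S. F S \<partial>samples) = (\<integral>h. (\<integral>S. surrogate h (gap S h) \<partial>samples) \<partial>P)"
      unfolding F_def by (rule pair.Fubini_integral[OF int])
    also have "\<dots> \<le> gap_bound"
      by (rule P.integral_le_const) (use pair.integrable_fst[OF int] surrogate_mean_le sp in \<open>auto intro!: AE_I2\<close>)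
    finally show ?thesis .
  qed
  let ?B = "{S \<in> space samples. (\<integral>S. F S \<partial>samples) + \<sigma> \<le> F S}"
  have "measure samples ?B \<le> exp (- 2 * \<sigma>\<^sup>2 / (real m * (1 / real m)\<^sup>2))"
  proof (rule McDiarmid_inequality[OF D m _ \<sigma>, where B = 2])
    fix S assume S: "S \<in> space samples"
    have "0 \<le> F S" unfolding F_def
      using surrogate_bounds(1)[OF _ S] sp by (intro integral_nonneg_AE AE_I2) auto
    moreover have "F S \<le> 2" unfolding F_def
      by (rule P.integral_le_const[OF intS[OF S]]) (use surrogate_bounds(2)[OF _ S] sp in \<open>auto intro!: AE_I2\<close>)
    ultimately show "\<bar>F S\<bar> \<le> 2" by simp
    fix i z assume i: "i < m" and z: "z \<in> space D"
    have S': "S(i := z) \<in> space samples" by (rule fun_upd_space_PiM_same[OF S z i])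
    have "F (S(i := z)) - F S = (\<integral>h. surrogate h (gap (S(i := z)) h) - surrogate h (gap S h) \<partial>P)"
      unfolding F_def by (rule Bochner_Integration.integral_diff[symmetric]) (use intS S S' in auto)
    also have "norm \<dots> \<le> (\<integral>h. norm (surrogate h (gap (S(i := z)) h) - surrogate h (gap S h)) \<partial>P)"
      by (rule integral_norm_bound)
    also have "\<dots> \<le> 1 / real m"
    proof (rule P.integral_le_const)
      show "integrable P (\<lambda>h. norm (surrogate h (gap (S(i := z)) h) - surrogate h (gap S h)))"
        by (intro integrable_norm Bochner_Integration.integrable_diff intS S S')
      show "AE h in P. norm (surrogate h (gap (S(i := z)) h) - surrogate h (gap S h)) \<le> 1 / real m"
      proof (rule AE_I2)
        fix h assume "h \<in> space P"
        hence h: "h \<in> space H" using sp by simp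
        show "norm (surrogate h (gap (S(i := z)) h) - surrogate h (gap S h)) \<le> 1 / real m"
          using surrogate_lipschitz[OF gap_bounds(1)[OF h S] gap_bounds(1)[OF h S'], of h]
            gap_diff_le[OF h S i z] by simp
      qed
    qed
    finally show "\<bar>F (S(i := z)) - F S\<bar> \<le> 1 / real m" by simp
  qed (use m in auto)
  \<comment> \<open>The value of \<sigma> makes the tail probability exactly \<delta>.\<close>
  also have "- 2 * \<sigma>\<^sup>2 / (real m * (1 / real m)\<^sup>2) = ln \<delta>"
  proof -
    have "\<sigma>\<^sup>2 = ln (1 / \<delta>) / (2 * real m)" unfolding \<sigma>_def using L m by (intro real_sqrt_pow2) auto
    thus ?thesis using m \<delta> by (simp add: ln_div power2_eq_square field_simps)
  qed
  finally have B: "measure samples ?B \<le> \<delta>" using \<delta> by simp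
  show ?thesis
  proof (intro bexI conjI ballI)
    show "space samples - ?B \<in> sets samples" by measurable
    show "1 - \<delta> \<le> measure samples (space samples - ?B)"
      using B by (subst PD.prob_compl) auto
    fix S assume "S \<in> space samples - ?B"
    hence "F S \<le> gap_bound + \<sigma>" using EF by auto
    thus "(\<integral>h. surrogate h (gap S h) \<partial>P) \<le> gap_bound + sqrt (ln (1 / \<delta>) / (2 * real m))"
      by (simp add: F_def \<sigma>_def)
  qed
qed

section \<open>Deterministic bounds for a good sample\<close>

context
  fixes \<Gamma> :: "('h \<Rightarrow> real) set" and P \<rho> \<eta> :: "'h measure" and S :: "nat \<Rightarrow> 'z" and \<sigma> :: real
  assumes gap_in: "\<And>S. S \<in> space samples \<Longrightarrow> gap S \<in> \<Gamma>"
    and P: "prob_space P" "sets P = sets H"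
    and \<rho>: "prob_space \<rho>" "sets \<rho> = sets H"
    and \<eta>: "prob_space \<eta>" "sets \<eta> = sets H"
    and S: "S \<in> space samples"
    and S_good: "(\<integral>h. surrogate h (gap S h) \<partial>P) \<le> gap_bound + \<sigma>"
begin

interpretation P: prob_space P by (rule P)
interpretation \<eta>: prob_space \<eta> by (rule \<eta>)

lemma W_Gamma_ge: "S' \<in> space samples \<Longrightarrow> ereal ((\<integral>h. gap S' h \<partial>\<rho>) - (\<integral>h. gap S' h \<partial>\<eta>)) \<le> W_Gamma \<Gamma> \<rho> \<eta>"
  unfolding W_Gamma_def by (rule SUP_upper) (rule gap_in)

text \<open>For each sample \<open>S'\<close> the gap has nonnegative mean under \<rho>, so testing
  with it gives minus its mean under \<eta>. Averaging over \<open>S'\<close> and exchanging the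
  integrals produces the mean gap.\<close>

lemma W_Gamma_ge_mean_gap: "ereal (- (\<integral>h. mean_gap h \<partial>\<eta>)) \<le> W_Gamma \<Gamma> \<rho> \<eta>"
proof (cases "W_Gamma \<Gamma> \<rho> \<eta>")
  case (real r)
  have "- r \<le> (\<integral>S'. (\<integral>h. gap S' h \<partial>\<eta>) \<partial>samples)"
  proof (rule PD.integral_ge_const[OF integral_gap_fubini(1)[OF \<eta>]], rule AE_I2)
    fix S' assume S': "S' \<in> space samples"
    have "0 \<le> (\<integral>h. gap S' h \<partial>\<rho>)"
      using gap_bounds(1)[OF _ S'] sets_eq_imp_space_eq[OF \<rho>(2)] by (intro integral_nonneg_AE AE_I2) auto
    thus "- r \<le> (\<integral>h. gap S' h \<partial>\<eta>)" using W_Gamma_ge[OF S'] real by simp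
  qed
  thus ?thesis using integral_gap_fubini(2)[OF \<eta>] real by simp
next
  case MInf
  thus ?thesis using W_Gamma_ge[OF S] by simp
qed simp

text \<open>Testing with the gap of \<open>S\<close> itself passes from \<rho> to \<eta>, total
  variation passes from \<eta> to \<open>P\<close>, and there the surrogate dominates the
  gap.\<close>

lemma TV_bound:
  "ereal (\<integral>h. gap S h \<partial>\<rho>) \<le> W_Gamma \<Gamma> \<rho> \<eta> + TV \<eta> P + ereal gap_bound + ereal \<sigma>"
proof -
  have spP: "space P = space H" by (rule sets_eq_imp_space_eq[OF P(2)])
  have gm: "gap S \<in> borel_measurable P"
    using gap_measurable_hyp[OF S] by (simp add: measurable_cong_sets[OF P(2) refl])
  have "(\<integral>h. gap S h \<partial>P) \<le> (\<integral>h. surrogate h (gap S h) \<partial>P)"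
    by (rule integral_mono[OF integrable_gap_hyp[OF P S] integrable_surrogate_hyp[OF P S] surrogate_ge])
  hence gP: "(\<integral>h. gap S h \<partial>P) \<le> gap_bound + \<sigma>" using S_good by linarith
  have "ereal (\<integral>h. gap S h \<partial>\<eta>) \<le> TV \<eta> P + ereal (\<integral>h. gap S h \<partial>P)"
    by (rule TV_change_of_measure[OF P(1) \<eta>(1)]) (use \<eta>(2) P(2) gm gap_bounds S spP in auto)
  thus ?thesis using W_Gamma_ge[OF S] gP
    by (cases "W_Gamma \<Gamma> \<rho> \<eta>"; cases "TV \<eta> P") auto
qed

text \<open>Stated for any \<open>X\<close> above the squared Hellinger distance, and any
  \<open>dev\<close> above the weighted deviation, so that one argument covers the Hellinger and the
  reverse KL bound.\<close>

lemma hellinger_type_bound: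
  assumes X: "hellinger2 \<eta> P \<le> X" and dev: "weight * \<sigma> \<le> dev"
  shows "ereal (\<integral>h. gap S h \<partial>\<rho>)
    \<le> 2 * W_Gamma \<Gamma> \<rho> \<eta> + 2 * X + ereal (sqrt (1 / real m)) + ereal dev"
proof -
  have spP: "space P = space H" by (rule sets_eq_imp_space_eq[OF P(2)])
  have sp\<eta>: "space \<eta> = space H" by (rule sets_eq_imp_space_eq[OF \<eta>(2)])
  define v where "v h = (gap S h + mean_gap h) / 2 - gap_bound" for h
  have mP: "borel_measurable P = (borel_measurable H :: ('h \<Rightarrow> real) set)" by (rule measurable_cong_sets[OF P(2) refl])
  have m\<eta>: "borel_measurable \<eta> = (borel_measurable H :: ('h \<Rightarrow> real) set)" by (rule measurable_cong_sets[OF \<eta>(2) refl])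
  have gm[measurable]: "gap S \<in> borel_measurable H" by (rule gap_measurable_hyp[OF S])
  have vm: "v \<in> borel_measurable H" unfolding v_def by measurable
  have v_lo: "- gap_bound \<le> v h" if "h \<in> space H" for h
    using gap_bounds(1)[OF that S] mean_gap_nonneg[OF that] by (simp add: v_def)
  have v_hi: "v h \<le> (1 - gap_bound) / 2" if "h \<in> space H" for h
    using gap_bounds(2)[OF that S] mean_gap_le[OF that] by (simp add: v_def field_simps)
  have c1: "(1 - gap_bound) / 2 < 1" using gap_bound_pos by simp
  note int_gap = integrable_gap_hyp[OF \<eta> S]
  have int_mean: "integrable \<eta> mean_gap"
    by (rule \<eta>.integrable_const_bound[of _ gap_bound])
       (use mean_gap_measurable m\<eta> mean_gap_nonneg mean_gap_le in \<open>auto intro!: AE_I2 simp: sp\<eta>\<close>)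
  have v_int: "2 * (\<integral>h. v h \<partial>\<eta>) = (\<integral>h. gap S h \<partial>\<eta>) + (\<integral>h. mean_gap h \<partial>\<eta>) - 2 * gap_bound"
    unfolding v_def using int_gap int_mean by (simp add: \<eta>.prob_space field_simps)
  have "2 * (\<integral>h. v h / (1 - v h) \<partial>P) = (\<integral>h. 2 * (v h / (1 - v h)) \<partial>P)"
    by (rule integral_mult_right_zero[symmetric])
  also have "\<dots> \<le> (\<integral>h. weight * (surrogate h (gap S h) - gap_bound) \<partial>P)"
  proof (rule integral_mono)
    show "integrable P (\<lambda>h. weight * (surrogate h (gap S h) - gap_bound))"
      using integrable_surrogate_hyp[OF P S] by simp
    have "\<bar>v h / (1 - v h)\<bar> \<le> (1 + gap_bound) / (1 - (1 - gap_bound) / 2)" if h: "h \<in> space H" for h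
      unfolding abs_divide by (rule frac_le) (use v_lo[OF h] v_hi[OF h] c1 gap_bound_pos in \<open>auto simp: abs_le_iff\<close>)
    moreover have "(\<lambda>h. v h / (1 - v h)) \<in> borel_measurable P" unfolding mP using vm by measurable
    ultimately have "integrable P (\<lambda>h. v h / (1 - v h))"
      by (intro P.integrable_const_bound[of _ "(1 + gap_bound) / (1 - (1 - gap_bound) / 2)"])
         (auto intro!: AE_I2 simp: spP)
    thus "integrable P (\<lambda>h. 2 * (v h / (1 - v h)))" by (rule integrable_mult_right)
    fix h assume "h \<in> space P"
    thus "2 * (v h / (1 - v h)) \<le> weight * (surrogate h (gap S h) - gap_bound)"
      unfolding v_def using surrogate_dominates[OF _ S] spP by simp
  qed
  also have "\<dots> = weight * ((\<integral>h. surrogate h (gap S h) \<partial>P) - gap_bound)"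
    using integrable_surrogate_hyp[OF P S] by (simp add: P.prob_space)
  also have "\<dots> \<le> weight * \<sigma>" using S_good weight_nonneg by (intro mult_left_mono) auto
  also have "\<dots> \<le> dev" by (rule dev)
  finally have vP: "2 * (\<integral>h. v h / (1 - v h) \<partial>P) \<le> dev" .
  have "ereal (\<integral>h. v h \<partial>\<eta>) \<le> hellinger2 \<eta> P + ereal (\<integral>h. v h / (1 - v h) \<partial>P)"
    by (rule hellinger_change_of_measure[OF P(1) \<eta>(1) _ _ _ _ c1, where B = gap_bound])
       (use \<eta>(2) P(2) vm mP v_lo v_hi spP in auto)
  hence vX: "ereal (\<integral>h. v h \<partial>\<eta>) \<le> X + ereal (\<integral>h. v h / (1 - v h) \<partial>P)"
    using X add_right_mono order_trans by blast
  have b: "2 * gap_bound = sqrt (1 / real m)" by (simp add: gap_bound_def real_sqrt_divide)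
  show ?thesis
  proof (cases "W_Gamma \<Gamma> \<rho> \<eta>")
    case (real r)
    \<comment> \<open>The two lower bounds on \<open>r\<close>, each used once, together account for
      the term \<open>2 * r\<close>.\<close>
    have r: "(\<integral>h. gap S h \<partial>\<rho>) - (\<integral>h. gap S h \<partial>\<eta>) \<le> r" "- (\<integral>h. mean_gap h \<partial>\<eta>) \<le> r"
      using W_Gamma_ge[OF S] W_Gamma_ge_mean_gap real by simp_all
    show ?thesis
    proof (cases X)
      case (real x)
      have "(\<integral>h. v h \<partial>\<eta>) \<le> x + (\<integral>h. v h / (1 - v h) \<partial>P)" using vX real by simp
      hence "(\<integral>h. gap S h \<partial>\<rho>) \<le> 2 * r + 2 * x + sqrt (1 / real m) + dev"
        using r v_int vP b by linarith
      thus ?thesis using real \<open>W_Gamma \<Gamma> \<rho> \<eta> = ereal r\<close> by simp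
    qed (use vX in auto)
  next
    case MInf
    thus ?thesis using W_Gamma_ge[OF S] by simp
  qed simp
qed

end

end

section \<open>One event for all three bounds, uniform in both posteriors\<close>

theorem theorem4p2:
  fixes H :: "'h measure" and D :: "'z measure" and l :: "'h \<Rightarrow> 'z \<Rightarrow> real"
    and \<Gamma> :: "('h \<Rightarrow> real) set" and P :: "'h measure" and m :: nat and \<delta> :: real
  assumes D: "prob_space D"
    and l_meas: "(\<lambda>(h, z). l h z) \<in> borel_measurable (H \<Otimes>\<^sub>M D)"
    and l_bdd: "\<And>h z. h \<in> space H \<Longrightarrow> z \<in> space D \<Longrightarrow> 0 \<le> l h z \<and> l h z \<le> 1"
    and m: "m > 0"
    and \<Gamma>: "\<Gamma> \<subseteq> Mb H"
    and gap_in: "\<And>S. S \<in> space (PiM {..<m} (\<lambda>_. D)) \<Longrightarrow> gen_gap D m l S \<in> \<Gamma>"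
    and P: "P \<in> space (prob_algebra H)"
    and \<delta>: "0 < \<delta>" "\<delta> < 1"
  shows "\<exists>A \<in> sets (PiM {..<m} (\<lambda>_. D)).
     measure (PiM {..<m} (\<lambda>_. D)) A \<ge> 1 - \<delta> \<and>
     (\<forall>S\<in>A. \<forall>\<rho>\<in>space (prob_algebra H). \<forall>\<eta>\<in>space (prob_algebra H).
        ereal (\<integral>h. gen_gap D m l S h \<partial>\<rho>)
          \<le> 2 * W_Gamma \<Gamma> \<rho> \<eta> + 2 * revKL \<eta> P + ereal (sqrt (1 / real m))
             + ereal (ln (1 + 1 / real m) * sqrt (2 * real m * ln (1 / \<delta>)))
      \<and> ereal (\<integral>h. gen_gap D m l S h \<partial>\<rho>)
          \<le> 2 * W_Gamma \<Gamma> \<rho> \<eta> + 2 * hellinger2 \<eta> P + ereal (sqrt (1 / real m))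
             + ereal (2 / (real m + 1) * sqrt (2 * real m * ln (1 / \<delta>)))
      \<and> ereal (\<integral>h. gen_gap D m l S h \<partial>\<rho>)
          \<le> W_Gamma \<Gamma> \<rho> \<eta> + TV \<eta> P + ereal (sqrt (1 / (4 * real m)))
             + ereal (sqrt (ln (1 / \<delta>) / (2 * real m))))"
proof -
  interpret bounded_loss H D l m by (rule bounded_loss.intro[OF D l_meas l_bdd m])
  define \<sigma> where "\<sigma> = sqrt (ln (1 / \<delta>) / (2 * real m))"
  have P': "prob_space P" "sets P = sets H" using P by (auto simp: space_prob_algebra)
  obtain A where A: "A \<in> sets samples" "1 - \<delta> \<le> measure samples A"
    and A_good: "\<And>S. S \<in> A \<Longrightarrow> (\<integral>h. surrogate h (gap S h) \<partial>P) \<le> gap_bound + \<sigma>"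
    using surrogate_event[OF P' \<delta>] unfolding \<sigma>_def by blast
  have \<sigma>0: "0 \<le> \<sigma>" using \<delta> m by (simp add: \<sigma>_def)
  \<comment> \<open>Expresses the root in the theorem through \<sigma>, so that \<open>dev1\<close>
    and \<open>dev2\<close> become the bounds on \<open>weight\<close> multiplied by
    \<sigma>.\<close>
  have root: "sqrt (2 * real m * ln (1 / \<delta>)) = 2 * real m * \<sigma>"
  proof (rule real_sqrt_unique)
    have "\<sigma>\<^sup>2 = ln (1 / \<delta>) / (2 * real m)" unfolding \<sigma>_def using \<delta> m by (intro real_sqrt_pow2) auto
    thus "(2 * real m * \<sigma>)\<^sup>2 = 2 * real m * ln (1 / \<delta>)"
      using m by (simp add: power_mult_distrib) (simp add: power2_eq_square)
  qed (use \<sigma>0 in simp)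
  have dev1: "weight * \<sigma> \<le> ln (1 + 1 / real m) * sqrt (2 * real m * ln (1 / \<delta>))"
    using mult_right_mono[OF weight_le_revKL \<sigma>0] unfolding root by (simp add: mult_ac)
  have dev2: "weight * \<sigma> \<le> 2 / (real m + 1) * sqrt (2 * real m * ln (1 / \<delta>))"
    using mult_right_mono[OF weight_le_hellinger \<sigma>0] unfolding root by (simp add: mult_ac)
  have b: "sqrt (1 / (4 * real m)) = gap_bound"
    by (simp add: gap_bound_def real_sqrt_divide real_sqrt_mult)
  show ?thesis
  proof (intro bexI[OF _ A(1)] conjI ballI A(2))
    fix S \<rho> \<eta> assume S: "S \<in> A" and "\<rho> \<in> space (prob_algebra H)" "\<eta> \<in> space (prob_algebra H)"
    hence \<rho>: "prob_space \<rho>" "sets \<rho> = sets H" and \<eta>: "prob_space \<eta>" "sets \<eta> = sets H"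
      by (auto simp: space_prob_algebra)
    have S': "S \<in> space samples" using sets.sets_into_space[OF A(1)] S by auto
    note ctx = gap_in P' \<rho> \<eta> S' A_good[OF S]
    have "hellinger2 \<eta> P \<le> revKL \<eta> P"
      by (rule hellinger2_le_revKL[OF P'(1) \<eta>(1)]) (simp add: P' \<eta>)
    from hellinger_type_bound[OF ctx this dev1]
    show "ereal (\<integral>h. gap S h \<partial>\<rho>)
          \<le> 2 * W_Gamma \<Gamma> \<rho> \<eta> + 2 * revKL \<eta> P + ereal (sqrt (1 / real m))
             + ereal (ln (1 + 1 / real m) * sqrt (2 * real m * ln (1 / \<delta>)))" .
    from hellinger_type_bound[OF ctx order_refl dev2]
    show "ereal (\<integral>h. gap S h \<partial>\<rho>)
          \<le> 2 * W_Gamma \<Gamma> \<rho> \<eta> + 2 * hellinger2 \<eta> P + ereal (sqrt (1 / real m))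
             + ereal (2 / (real m + 1) * sqrt (2 * real m * ln (1 / \<delta>)))" .
    from TV_bound[OF ctx]
    show "ereal (\<integral>h. gap S h \<partial>\<rho>)
          \<le> W_Gamma \<Gamma> \<rho> \<eta> + TV \<eta> P + ereal (sqrt (1 / (4 * real m)))
             + ereal (sqrt (ln (1 / \<delta>) / (2 * real m)))"
      unfolding b \<sigma>_def .
  qed
qed

end
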